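(* Assume (H1)–(H4) and $2\alpha+\gamma>0$. Fix $n\in\mathbb N$ and let $$\rho_2:=6(\lambda_n^2+\bar L)(|2\alpha-\gamma|+1)+3+7\bar L+\lambda_n^2\bar L+6\lambda_n^2.$$ If the stepsize satisfies $\Delta<\min\{1,(2\alpha+\gamma)^2/(4\rho_2^2)\}$, then for every bounded subset $U\subset H_n$, $$\lim_{t\to\infty}\sup_{x_n,y_n\in U}\mathbb E\|Y^{n,\Delta}_{x_n}(t)-Y^{n,\Delta}_{y_n}(t)\|_H^2=0.$$ In particular the discrete EI scheme has Property (P2) for such $\Delta$.
   Context: $H$ real separable Hilbert space; $\|\cdot\|$ operator norm, $\|\cdot\|_{HS}$ Hilbert–Schmidt norm. $W$ cylindrical $\mathrm{id}_H$-Wiener process. $b:H\to H$, $\sigma(x)=\sigma^0+\sigma^1(x)$, $\sigma^0$ bounded linear, $\sigma^1:H\to\mathscr L_{HS}(H)$. (H1): $A$ self-adjoint, generating an immediately compact $C_0$-semigroup with $\|e^{tA}\|\le e^{-\alpha t}$, $\alpha>0$; $-A$ has eigenvalues $0<\lambda_1\le\lambda_2\le\cdots\to\infty$ with orthonormal eigenbasis $\{e_i\}$. (H2): there are $\theta_1\in(0,1)$, $\delta_1>0$ with $\int_0^t\|(-A)^{\theta_1}e^{sA}\sigma^0\|_{HS}^2ds\le\delta_1$ for all $t>0$, $(-A)^{\theta}=\sum_k\lambda_k^\theta e_k\otimes e_k$. (H3): $b$ is $L_1$-Lipschitz and $\sigma^1$ is $L_2$-Lipschitz into $\mathscr L_{HS}(H)$.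 (H4): there is $\gamma\in\mathbb R$ with $2\langle x-y,b(x)-b(y)\rangle_H+\|\sigma^1(x)-\sigma^1(y)\|_{HS}^2\le-\gamma\|x-y\|_H^2$ for all $x,y\in H$. $\mu:=\|b(0)\|_H^2+\|\sigma^1(0)\|_{HS}^2$, $\bar L:=2\max\{L_1^2+L_2^2,\mu\}$. $H_n=\mathrm{span}\{e_1,\dots,e_n\}$, $\pi_n$ orthogonal projection, $b_n=\pi_nb$, $\sigma_n=\pi_n\sigma$. $\lfloor t\rfloor:=[t/\Delta]\Delta$. Continuous EI scheme: $Y^{n,\Delta}_{x_n}(t)=e^{tA}x_n+\int_0^te^{(t-\lfloor s\rfloor)A}b_n(Y^{n,\Delta}_{x_n}(\lfloor s\rfloor))ds+\int_0^te^{(t-\lfloor s\rfloor)A}\sigma_n(Y^{n,\Delta}_{x_n}(\lfloor s\rfloor))dW(s)$; it coincides at grid points with the discrete EI scheme $\bar Y^{n,\Delta}_{x_n}(0)=x_n$, $\bar Y^{n,\Delta}_{x_n}((k+1)\Delta)=e^{\Delta A}\{\bar Y^{n,\Delta}_{x_n}(k\Delta)+b_n(\bar Y^{n,\Delta}_{x_n}(k\Delta))\Delta+\sigma_n(\bar Y^{n,\Delta}_{x_n}(k\Delta))(W((k+1)\Delta)-W(k\Delta))\}$. Property (P2): for every bounded $U\subset H_n$, $\lim_{k\to\infty}\sup_{x_n,y_n\in U}\mathbb E\|\bar Y^{n,\Delta}_{x_n}(k\Delta)-\bar Y^{n,\Delta}_{y_n}(k\Delta)\|_H^2=0$. *)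

theory Defs
  imports "HOL-Probability.Probability"
begin

definition orthonormal_basis :: "(nat \<Rightarrow> 'h::{real_inner,complete_space}) \<Rightarrow> bool" where
  "orthonormal_basis e \<longleftrightarrow>
     (\<forall>i j. e i \<bullet> e j = (if i = j then 1 else 0)) \<and> closure (span (range e)) = UNIV"

text \<open>Squared Hilbert-Schmidt norm w.r.t. the orthonormal basis e (value in ennreal,
  infinite iff the operator is not Hilbert-Schmidt).\<close>
definition hs_sq :: "(nat \<Rightarrow> 'h::real_inner) \<Rightarrow> ('h \<Rightarrow> 'h) \<Rightarrow> ennreal" where
  "hs_sq e T = (\<Sum>j. ennreal ((norm (T (e j)))\<^sup>2))"

text \<open>Semigroup e^{tA}, where A is self-adjoint with -A e_i = lam_i e_i.\<close>
definition semigrp :: "(nat \<Rightarrow> 'h::real_inner) \<Rightarrow> (nat \<Rightarrow> real) \<Rightarrow> real \<Rightarrow> 'h \<Rightarrow> 'h" where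
  "semigrp e lam t x = (\<Sum>i. (exp (- lam i * t) * (x \<bullet> e i)) *\<^sub>R e i)"

text \<open>(-A)^theta e^{sA} applied to x.\<close>
definition frac_semigrp ::
  "(nat \<Rightarrow> 'h::real_inner) \<Rightarrow> (nat \<Rightarrow> real) \<Rightarrow> real \<Rightarrow> real \<Rightarrow> 'h \<Rightarrow> 'h" where
  "frac_semigrp e lam \<theta> s x = (\<Sum>i. (lam i powr \<theta> * exp (- lam i * s) * (x \<bullet> e i)) *\<^sub>R e i)"

definition proj :: "(nat \<Rightarrow> 'h::real_inner) \<Rightarrow> nat \<Rightarrow> 'h \<Rightarrow> 'h" where
  "proj e n x = (\<Sum>i<n. (x \<bullet> e i) *\<^sub>R e i)"

text \<open>Cylindrical id_H-Wiener process, given through its coordinates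
  beta k t = <W(t), e_k>: a family of independent standard real Brownian motions.
  The finite-dimensional distributions are fixed by requiring that, for every finite
  time grid 0 <= tau 0 < ... < tau m, all increments (over all k and all grid intervals)
  are independent centred Gaussians with variance the length of the interval.\<close>
definition cyl_wiener :: "'w measure \<Rightarrow> (nat \<Rightarrow> real \<Rightarrow> 'w \<Rightarrow> real) \<Rightarrow> bool" where
  "cyl_wiener M \<beta> \<longleftrightarrow>
     prob_space M \<and>
     (\<forall>k t. \<beta> k t \<in> borel_measurable M) \<and>
     (\<forall>k. AE \<omega> in M. \<beta> k 0 \<omega> = 0) \<and>
     (\<forall>k. AE \<omega> in M. continuous_on {0..} (\<lambda>t. \<beta> k t \<omega>)) \<and>
     (\<forall>(m::nat) (\<tau>::nat \<Rightarrow> real). 0 \<le> \<tau> 0 \<and> (\<forall>i<m. \<tau> i < \<tau> (Suc i)) \<longrightarrow>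
        prob_space.indep_vars M (\<lambda>_. borel)
          (\<lambda>ki \<omega>. \<beta> (fst ki) (\<tau> (Suc (snd ki))) \<omega> - \<beta> (fst ki) (\<tau> (snd ki)) \<omega>) (UNIV \<times> {..<m}) \<and>
        (\<forall>k. \<forall>i<m. distributed M lborel (\<lambda>\<omega>. \<beta> k (\<tau> (Suc i)) \<omega> - \<beta> k (\<tau> i) \<omega>)
                        (normal_density 0 (sqrt (\<tau> (Suc i) - \<tau> i)))))"

text \<open>The noise term sigma_n(y)(W(b) - W(a)) = pi_n sigma(y) (W(b) - W(a)), in coordinates:
  its i-th coordinate (i < n) is  sum_k (beta_k(b) - beta_k(a)) <sigma(y) e_k, e_i>.\<close>
definition noise_incr ::
  "(nat \<Rightarrow> 'h::real_inner) \<Rightarrow> nat \<Rightarrow> ('h \<Rightarrow> 'h) \<Rightarrow> (nat \<Rightarrow> real \<Rightarrow> 'w \<Rightarrow> real)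
     \<Rightarrow> real \<Rightarrow> real \<Rightarrow> 'w \<Rightarrow> 'h" where
  "noise_incr e n S \<beta> a b \<omega> =
     (\<Sum>i<n. (\<Sum>k. (\<beta> k b \<omega> - \<beta> k a \<omega>) * (S (e k) \<bullet> e i)) *\<^sub>R e i)"

text \<open>Right-hand side of the continuous exponential integrator scheme at time t, with the
  (elementary) Lebesgue and stochastic integrals written out: on [j Delta, (j+1) Delta) the
  integrands are constant, equal to e^{(t - j Delta)A} b_n(Y(j Delta)) and
  e^{(t - j Delta)A} sigma_n(Y(j Delta)), respectively.\<close>
definition EI_rhs ::
  "(nat \<Rightarrow> 'h::real_inner) \<Rightarrow> (nat \<Rightarrow> real) \<Rightarrow> nat \<Rightarrow> real \<Rightarrow> ('h \<Rightarrow> 'h) \<Rightarrow> ('h \<Rightarrow> 'h \<Rightarrow> 'h)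
     \<Rightarrow> (nat \<Rightarrow> real \<Rightarrow> 'w \<Rightarrow> real) \<Rightarrow> 'h \<Rightarrow> (real \<Rightarrow> 'w \<Rightarrow> 'h) \<Rightarrow> real \<Rightarrow> 'w \<Rightarrow> 'h" where
  "EI_rhs e lam n \<Delta> b \<sigma> \<beta> x Y t \<omega> =
     semigrp e lam t x +
     (\<Sum>j\<in>{j::nat. real j * \<Delta> < t}.
        semigrp e lam (t - real j * \<Delta>)
          ((min t (real (Suc j) * \<Delta>) - real j * \<Delta>) *\<^sub>R proj e n (b (Y (real j * \<Delta>) \<omega>))
           + noise_incr e n (\<sigma> (Y (real j * \<Delta>) \<omega>)) \<beta> (real j * \<Delta>) (min t (real (Suc j) * \<Delta>)) \<omega>))"

end

theory Submission
  imports Defs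
begin

text \<open>
  On one step of length \<open>h \<le> \<Delta>\<close> the increment of the Wiener process is independent of the two
  numerical solutions at the start of the step. Conditioning on the latter, the two solutions differ by
  \<open>e\<^sup>h\<^sup>A\<close> applied to \<open>D + h \<delta>b + \<delta>\<sigma> \<delta>W\<close>, whose mean square is at most
  \<open>e\<^sup>-\<^sup>2\<^sup>\<alpha>\<^sup>h\<close> times \<open>\<parallel>D\<parallel>\<^sup>2 + 2h \<langle>D, \<delta>b\<rangle> + h \<parallel>\<delta>\<sigma>\<parallel>\<^sup>2 + h\<^sup>2 \<parallel>\<delta>b\<parallel>\<^sup>2\<close>,
  hence by (H3) and (H4) at most \<open>e\<^sup>-\<^sup>2\<^sup>\<alpha>\<^sup>h (1 - \<gamma> h + L\<^sub>1\<^sup>2 h\<^sup>2)\<close> times \<open>\<parallel>D\<parallel>\<^sup>2\<close>. Since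
  \<open>e\<^sup>2\<^sup>\<alpha>\<^sup>\<Delta> \<ge> 1 + 2\<alpha>\<Delta>\<close>, the factor is smaller than 1 for \<open>h = \<Delta>\<close> as soon as
  \<open>L\<^sub>1\<^sup>2 \<Delta> < 2\<alpha> + \<gamma>\<close>, which the step size condition implies. This gives geometric decay
  along the grid and, with a bounded factor, between grid points.

  The noise coefficients \<open>\<sigma>\<^sup>0 + \<sigma>\<^sup>1\<close> need not be Hilbert-Schmidt; each coordinate of the noise
  is an infinite random series with square summable coefficients, and its almost sure convergence
  comes from Kolmogorov's maximal inequality.
\<close>

subsection \<open>Series of independent random variables\<close>

text \<open>Grouping independent variables into disjoint blocks keeps them independent; here the
  blocks are the singletons \<open>{f j}\<close>, disjoint because \<open>f\<close> is
  injective.\<close>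

lemma (in prob_space) indep_vars_reindex:
  assumes indep: "indep_vars M' X I" and f: "inj_on f J" "f ` J \<subseteq> I"
  shows "indep_vars (\<lambda>j. M' (f j)) (\<lambda>j. X (f j)) J"
proof -
  have "indep_vars (\<lambda>j. PiM {f j} M') (\<lambda>j \<omega>. restrict (\<lambda>i. X i \<omega>) {f j}) J"
    using f by (intro indep_vars_restrict[OF indep]) (auto simp: disjoint_family_on_def inj_on_def)
  then have "indep_vars (\<lambda>j. M' (f j)) (\<lambda>j \<omega>. (\<lambda>z. z (f j)) (restrict (\<lambda>i. X i \<omega>) {f j})) J"
    by (rule indep_vars_compose2) auto
  then show ?thesis by simp
qed

text \<open>A martingale transform: each weight \<open>p k\<close> sees only the variables before
  \<open>X k\<close>, so cross terms have mean zero, and weights bounded by 1 do not increase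
  variances. It serves once with stopping weights and once with weights constantly 1 and offset
  \<open>c\<close>.\<close>

lemma (in prob_space) predictable_sum_second_moment:
  fixes X :: "nat \<Rightarrow> 'a \<Rightarrow> real" and c :: real
  assumes indep: "indep_vars (\<lambda>_. borel) X UNIV"
    and sq: "\<And>k. integrable M (\<lambda>\<omega>. (X k \<omega>)\<^sup>2)"
    and mean: "\<And>k. expectation (X k) = 0"
    and p: "\<And>k. p k \<in> borel_measurable (PiM {..<k} (\<lambda>_. borel))"
    and p1: "\<And>k z. \<bar>p k z\<bar> \<le> 1"
  defines "T \<equiv> \<lambda>N \<omega>. c + (\<Sum>k<N. p k (restrict (\<lambda>i. X i \<omega>) {..<k}) * X k \<omega>)"
  shows "integrable M (\<lambda>\<omega>. (T N \<omega>)\<^sup>2)"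
    and "expectation (\<lambda>\<omega>. (T N \<omega>)\<^sup>2) \<le> c\<^sup>2 + (\<Sum>k<N. expectation (\<lambda>\<omega>. (X k \<omega>)\<^sup>2))"
proof -
  have Xm[measurable]: "X k \<in> borel_measurable M" for k
    using indep unfolding indep_vars_def by auto
  have Xi: "integrable M (X k)" for k
    by (rule square_integrable_imp_integrable[OF Xm sq])
  have past: "(\<lambda>\<omega>. restrict (\<lambda>i. X i \<omega>) {..<k}) \<in> measurable M (PiM {..<k} (\<lambda>_. borel))" for k
    by (intro measurable_restrict Xm)
  have pm[measurable]: "(\<lambda>\<omega>. p k (restrict (\<lambda>i. X i \<omega>) {..<k})) \<in> borel_measurable M" for k
    by (rule measurable_compose[OF past p])
  have Tm[measurable]: "T N \<in> borel_measurable M" for N unfolding T_def by measurable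
  have "integrable M (\<lambda>\<omega>. (T N \<omega>)\<^sup>2) \<and>
     expectation (\<lambda>\<omega>. (T N \<omega>)\<^sup>2) \<le> c\<^sup>2 + (\<Sum>k<N. expectation (\<lambda>\<omega>. (X k \<omega>)\<^sup>2))"
  proof (induction N)
    case 0
    then show ?case by (simp add: T_def prob_space)
  next
    case (Suc N)
    define P where "P \<omega> = p N (restrict (\<lambda>i. X i \<omega>) {..<N})" for \<omega>
    \<comment> \<open>\<open>g\<close> exhibits \<open>P * T N\<close> as one measurable function of
      the first \<open>N\<close> variables, the form in which independence from \<open>X N\<close>
      applies.\<close>
    define g where "g z = p N z * (c + (\<Sum>k<N. p k (restrict z {..<k}) * z k))" for z
    have [measurable]: "P \<in> borel_measurable M" unfolding P_def by measurable
    have P1: "\<bar>P \<omega>\<bar> \<le> 1" for \<omega> by (simp add: P_def p1)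
    have iT: "integrable M (\<lambda>\<omega>. (T N \<omega>)\<^sup>2)" using Suc by simp
    have PT: "(\<lambda>\<omega>. P \<omega> * T N \<omega>) = (\<lambda>\<omega>. g (restrict (\<lambda>i. X i \<omega>) {..<N}))"
    proof
      fix \<omega>
      have "restrict (restrict (\<lambda>i. X i \<omega>) {..<N}) {..<k} = restrict (\<lambda>i. X i \<omega>) {..<k}" if "k < N" for k
        using that by (auto simp: restrict_def fun_eq_iff)
      then show "P \<omega> * T N \<omega> = g (restrict (\<lambda>i. X i \<omega>) {..<N})"
        by (simp add: P_def T_def g_def)
    qed
    have pk: "(\<lambda>z. p k (restrict z {..<k})) \<in> borel_measurable (PiM {..<N} (\<lambda>_. borel))" if "k < N" for k
      by (rule measurable_compose[OF measurable_restrict_subset p]) (use that in auto)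
    have gm: "g \<in> borel_measurable (PiM {..<N} (\<lambda>_. borel))"
      unfolding g_def
      by (intro borel_measurable_times borel_measurable_add borel_measurable_sum p pk borel_measurable_const
           measurable_component_singleton) auto
    have "indep_var (PiM {..<N} (\<lambda>_. borel)) (\<lambda>\<omega>. restrict (\<lambda>i. X i \<omega>) {..<N})
       (PiM {N} (\<lambda>_. borel)) (\<lambda>\<omega>. restrict (\<lambda>i. X i \<omega>) {N})"
      by (rule indep_var_restrict[OF indep]) auto
    from indep_var_compose[OF this gm, of "\<lambda>f. f N" borel]
    have ind: "indep_var borel (\<lambda>\<omega>. P \<omega> * T N \<omega>) borel (X N)"
      by (simp add: PT comp_def)
    have bd: "(P \<omega> * Z)\<^sup>2 \<le> Z\<^sup>2" for \<omega> Z
      using P1[of \<omega>] by (simp add: power_mult_distrib abs_square_le_1 mult_left_le_one_le)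
    have "integrable M (\<lambda>\<omega>. (P \<omega> * T N \<omega>)\<^sup>2)"
      by (rule Bochner_Integration.integrable_bound[OF iT]) (auto intro!: AE_I2 bd)
    then have iPT: "integrable M (\<lambda>\<omega>. P \<omega> * T N \<omega>)"
      by (rule square_integrable_imp_integrable[rotated]) simp
    have iPX: "integrable M (\<lambda>\<omega>. (P \<omega> * X N \<omega>)\<^sup>2)"
      by (rule Bochner_Integration.integrable_bound[OF sq[of N]]) (auto intro!: AE_I2 bd)
    have icr: "integrable M (\<lambda>\<omega>. (P \<omega> * T N \<omega>) * X N \<omega>)"
      by (rule indep_var_integrable[OF ind iPT Xi])
    have ecr: "expectation (\<lambda>\<omega>. (P \<omega> * T N \<omega>) * X N \<omega>) = 0"
      using indep_var_lebesgue_integral[OF ind iPT Xi] by (simp add: mean)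
    have T: "(T (Suc N) \<omega>)\<^sup>2 = (T N \<omega>)\<^sup>2 + 2 * ((P \<omega> * T N \<omega>) * X N \<omega>) + (P \<omega> * X N \<omega>)\<^sup>2" for \<omega>
      by (simp add: T_def P_def power2_eq_square algebra_simps)
    have "expectation (\<lambda>\<omega>. (P \<omega> * X N \<omega>)\<^sup>2) \<le> expectation (\<lambda>\<omega>. (X N \<omega>)\<^sup>2)"
      by (rule integral_mono[OF iPX sq]) (rule bd)
    then show ?case using Suc iT icr iPX ecr unfolding T by simp
  qed
  then show "integrable M (\<lambda>\<omega>. (T N \<omega>)\<^sup>2)"
    and "expectation (\<lambda>\<omega>. (T N \<omega>)\<^sup>2) \<le> c\<^sup>2 + (\<Sum>k<N. expectation (\<lambda>\<omega>. (X k \<omega>)\<^sup>2))" by auto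
qed

lemma (in prob_space) Kolmogorov_maximal_inequality:
  fixes X :: "nat \<Rightarrow> 'a \<Rightarrow> real"
  assumes indep: "indep_vars (\<lambda>_. borel) X UNIV"
    and sq: "\<And>k. integrable M (\<lambda>\<omega>. (X k \<omega>)\<^sup>2)"
    and mean: "\<And>k. expectation (X k) = 0"
    and V: "\<And>N. (\<Sum>k<N. expectation (\<lambda>\<omega>. (X k \<omega>)\<^sup>2)) \<le> V"
    and eps: "0 < \<epsilon>"
  shows "prob {\<omega> \<in> space M. \<exists>m. \<epsilon> \<le> \<bar>\<Sum>k<m. X k \<omega>\<bar>} \<le> V / \<epsilon>\<^sup>2"
proof -
  have Xm[measurable]: "X k \<in> borel_measurable M" for k
    using indep unfolding indep_vars_def by auto
  \<comment> \<open>The partial sum with \<open>i = k\<close> contains only indices below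
    \<open>k\<close>: including it keeps the weight predictable and stops the walk immediately after
    the level is reached.\<close>
  define p where "p k z = (if \<forall>i\<in>{..k}. \<bar>\<Sum>j<i. z j\<bar> < \<epsilon> then 1 else 0 :: real)" for k and z :: "nat \<Rightarrow> real"
  have zm: "(\<lambda>z. \<Sum>j<i. z j) \<in> borel_measurable (PiM {..<k} (\<lambda>_. borel :: real measure))" if "i \<le> k" for i k :: nat
    using that by (auto intro!: borel_measurable_sum measurable_component_singleton)
  have pm: "p k \<in> borel_measurable (PiM {..<k} (\<lambda>_. borel))" for k
  proof -
    have [measurable]: "(\<lambda>z. \<Sum>j<i. z j) \<in> borel_measurable (PiM {..<k} (\<lambda>_. borel :: real measure))"
      if "i \<in> {..k}" for i using zm that by auto
    show ?thesis unfolding p_def by measurable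
  qed
  define T where "T N \<omega> = (\<Sum>k<N. p k (restrict (\<lambda>i. X i \<omega>) {..<k}) * X k \<omega>)" for N \<omega>
  have p_restrict: "p k (restrict (\<lambda>i. X i \<omega>) {..<k}) = p k (\<lambda>i. X i \<omega>)" for k \<omega>
  proof -
    have "(\<Sum>j<i. restrict (\<lambda>i. X i \<omega>) {..<k} j) = (\<Sum>j<i. X j \<omega>)" if "i \<le> k" for i
      using that by (intro sum.cong) auto
    then show ?thesis by (simp add: p_def)
  qed
  have p1: "\<bar>p k z\<bar> \<le> 1" for k z by (simp add: p_def)
  have mom: "integrable M (\<lambda>\<omega>. (T N \<omega>)\<^sup>2)"
    "expectation (\<lambda>\<omega>. (T N \<omega>)\<^sup>2) \<le> (\<Sum>k<N. expectation (\<lambda>\<omega>. (X k \<omega>)\<^sup>2))" for N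
    using predictable_sum_second_moment[OF indep sq mean pm p1, of 0 N] by (simp_all add: T_def)
  have stopped: "\<epsilon> \<le> \<bar>T N \<omega>\<bar>" if "m \<le> N" "\<epsilon> \<le> \<bar>\<Sum>k<m. X k \<omega>\<bar>" for m N \<omega>
  proof -
    \<comment> \<open>\<open>l\<close> is the first passage time: weights are 1 before
      \<open>l\<close> and 0 from \<open>l\<close> on, so the stopped sum is the partial sum at
      \<open>l\<close>.\<close>
    define l where "l = (LEAST m. \<epsilon> \<le> \<bar>\<Sum>k<m. X k \<omega>\<bar>)"
    have l: "\<epsilon> \<le> \<bar>\<Sum>k<l. X k \<omega>\<bar>" unfolding l_def using that(2) by (rule LeastI)
    have lm: "l \<le> m" unfolding l_def using that(2) by (rule Least_le)
    have less: "\<bar>\<Sum>k<i. X k \<omega>\<bar> < \<epsilon>" if "i < l" for i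
      using not_less_Least[of i "\<lambda>m. \<epsilon> \<le> \<bar>\<Sum>k<m. X k \<omega>\<bar>"] that unfolding l_def by force
    have "T N \<omega> = (\<Sum>k<N. if k < l then X k \<omega> else 0)"
      unfolding T_def p_restrict
    proof (intro sum.cong refl)
      fix k
      show "p k (\<lambda>i. X i \<omega>) * X k \<omega> = (if k < l then X k \<omega> else 0)"
      proof (cases "k < l")
        case True
        then have "p k (\<lambda>i. X i \<omega>) = 1" using less by (auto simp: p_def)
        then show ?thesis using True by simp
      next
        case False
        then have "p k (\<lambda>i. X i \<omega>) = 0" using l by (auto simp: p_def not_less intro!: bexI[of _ l])
        then show ?thesis using False by simp
      qed
    qed
    also have "\<dots> = (\<Sum>k<l. X k \<omega>)"
      using lm that(1) by (intro sum.mono_neutral_cong_right) auto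
    finally show ?thesis using l by simp
  qed
  define A where "A N = {\<omega> \<in> space M. \<exists>m\<le>N. \<epsilon> \<le> \<bar>\<Sum>k<m. X k \<omega>\<bar>}" for N
  have [measurable]: "A N \<in> sets M" for N unfolding A_def by measurable
  have pN: "prob (A N) \<le> V / \<epsilon>\<^sup>2" for N
  proof -
    have [measurable]: "T N \<in> borel_measurable M"
      unfolding T_def by (intro borel_measurable_sum borel_measurable_times Xm
          measurable_compose[OF measurable_restrict pm])
    have "prob (A N) \<le> prob {\<omega> \<in> space M. \<epsilon>\<^sup>2 \<le> (T N \<omega>)\<^sup>2}"
    proof (rule finite_measure_mono)
      show "A N \<subseteq> {\<omega> \<in> space M. \<epsilon>\<^sup>2 \<le> (T N \<omega>)\<^sup>2}"
        using stopped eps by (force simp: A_def abs_le_square_iff[symmetric])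
    qed measurable
    also have "\<dots> \<le> expectation (\<lambda>\<omega>. (T N \<omega>)\<^sup>2) / \<epsilon>\<^sup>2"
      using eps by (intro integral_Markov_inequality_measure[where A="{}"] mom(1)) auto
    also have "\<dots> \<le> V / \<epsilon>\<^sup>2"
      using order_trans[OF mom(2) V] by (intro divide_right_mono) auto
    finally show ?thesis .
  qed
  have "(\<lambda>N. prob (A N)) \<longlonglongrightarrow> prob (\<Union>N. A N)"
    by (rule finite_Lim_measure_incseq) (auto simp: A_def incseq_def intro: order_trans)
  then have "prob (\<Union>N. A N) \<le> V / \<epsilon>\<^sup>2"
    using pN by (intro LIMSEQ_le_const2) auto
  also have "(\<Union>N. A N) = {\<omega> \<in> space M. \<exists>m. \<epsilon> \<le> \<bar>\<Sum>k<m. X k \<omega>\<bar>}"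
    by (auto simp: A_def)
  finally show ?thesis .
qed

text \<open>Kolmogorov's one-series theorem. The maximal inequality for the sequence shifted by
  \<open>N\<close> bounds the probability of a large fluctuation after \<open>N\<close> by a tail of
  the variance series; vanishing tails yield the Cauchy criterion almost surely.\<close>

lemma (in prob_space) AE_summable_if_summable_variance:
  fixes X :: "nat \<Rightarrow> 'a \<Rightarrow> real"
  assumes indep: "indep_vars (\<lambda>_. borel) X UNIV"
    and sq: "\<And>k. integrable M (\<lambda>\<omega>. (X k \<omega>)\<^sup>2)"
    and mean: "\<And>k. expectation (X k) = 0"
    and var: "summable (\<lambda>k. expectation (\<lambda>\<omega>. (X k \<omega>)\<^sup>2))"
  shows "AE \<omega> in M. summable (\<lambda>k. X k \<omega>)"
proof -
  have Xm[measurable]: "X k \<in> borel_measurable M" for k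
    using indep unfolding indep_vars_def by auto
  define v where "v k = expectation (\<lambda>\<omega>. (X k \<omega>)\<^sup>2)" for k
  have v0: "0 \<le> v k" for k by (simp add: v_def)
  have sv: "summable v" using var by (simp add: v_def[abs_def])
  define B where "B \<epsilon> N = {\<omega> \<in> space M. \<exists>m. \<epsilon> \<le> \<bar>\<Sum>k<m. X (k + N) \<omega>\<bar>}" for \<epsilon> :: real and N
  have [measurable]: "B \<epsilon> N \<in> sets M" for \<epsilon> N unfolding B_def by measurable
  have ae: "AE \<omega> in M. \<exists>N. \<omega> \<notin> B \<epsilon> N" if "0 < \<epsilon>" for \<epsilon>
  proof -
    have bd: "prob (B \<epsilon> N) \<le> (\<Sum>k. v (k + N)) / \<epsilon>\<^sup>2" for N
      unfolding B_def
    proof (rule Kolmogorov_maximal_inequality)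
      show "indep_vars (\<lambda>_. borel) (\<lambda>k. X (k + N)) UNIV"
        by (rule indep_vars_reindex[OF indep]) auto
      show "(\<Sum>k<K. expectation (\<lambda>\<omega>. (X (k + N) \<omega>)\<^sup>2)) \<le> (\<Sum>k. v (k + N))" for K
        unfolding v_def[symmetric]
        by (rule sum_le_suminf) (auto simp: summable_iff_shift sv v0)
    qed (auto simp: sq mean that)
    \<comment> \<open>The left side is free of \<open>N\<close> while the tails on the right tend to
      0, so the intersection is a null set.\<close>
    have "prob (\<Inter>N. B \<epsilon> N) \<le> (\<Sum>k. v (k + N)) / \<epsilon>\<^sup>2" for N
      by (rule order_trans[OF finite_measure_mono bd]) auto
    moreover have "(\<lambda>N. (\<Sum>k. v (k + N)) / \<epsilon>\<^sup>2) \<longlonglongrightarrow> 0"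
      using tendsto_divide[OF suminf_exist_split2[OF sv] tendsto_const] that by fastforce
    ultimately have "prob (\<Inter>N. B \<epsilon> N) \<le> 0"
      by (intro LIMSEQ_le_const) auto
    then have "prob (\<Inter>N. B \<epsilon> N) = 0" by (simp add: measure_le_0_iff)
    then have "(\<Inter>N. B \<epsilon> N) \<in> null_sets M"
      by (intro null_setsI) (auto simp: emeasure_eq_measure)
    then show ?thesis by (rule AE_I') auto
  qed
  \<comment> \<open>Only countably many thresholds are used, so the exceptional sets still unite to
    a null set.\<close>
  have "AE \<omega> in M. \<forall>r. \<exists>N. \<omega> \<notin> B (inverse (real (Suc r))) N"
    by (subst AE_all_countable) (auto intro: ae)
  then show ?thesis
  proof (rule AE_mp, intro AE_I2 impI)
    fix \<omega> assume \<omega>: "\<omega> \<in> space M" "\<forall>r. \<exists>N. \<omega> \<notin> B (inverse (real (Suc r))) N"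
    have "\<exists>N. \<forall>m\<ge>N. \<forall>n. norm (sum (\<lambda>k. X k \<omega>) {m..<n}) < \<epsilon>" if eps: "0 < \<epsilon>" for \<epsilon>
    proof -
      obtain r where r: "inverse (real (Suc r)) < \<epsilon> / 2"
        using reals_Archimedean[of "\<epsilon> / 2"] eps by auto
      obtain N where N: "\<omega> \<notin> B (inverse (real (Suc r))) N" using \<omega>(2) by blast
      \<comment> \<open>Half of \<open>\<epsilon>\<close>, since a block from \<open>m\<close> to
        \<open>n\<close> is the difference of two blocks starting at \<open>N\<close>.\<close>
      have tail: "\<bar>sum (\<lambda>k. X k \<omega>) {N..<m}\<bar> < \<epsilon> / 2" if "N \<le> m" for m
      proof -
        have "sum (\<lambda>k. X k \<omega>) {N..<m} = (\<Sum>k<m - N. X (k + N) \<omega>)"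
          using sum.shift_bounds_nat_ivl[of "\<lambda>k. X k \<omega>" 0 N "m - N"] that
          by (simp add: atLeast0LessThan)
        moreover have "\<bar>\<Sum>k<m - N. X (k + N) \<omega>\<bar> < inverse (real (Suc r))"
          using N \<omega>(1) by (auto simp: B_def not_le)
        ultimately show ?thesis using r by simp
      qed
      show ?thesis
      proof (intro exI[of _ N] allI impI)
        fix m n assume m: "N \<le> m"
        show "norm (sum (\<lambda>k. X k \<omega>) {m..<n}) < \<epsilon>"
        proof (cases "m \<le> n")
          case True
          have "sum (\<lambda>k. X k \<omega>) {N..<n} = sum (\<lambda>k. X k \<omega>) {N..<m} + sum (\<lambda>k. X k \<omega>) {m..<n}"
            using sum.atLeastLessThan_concat[OF m True, of "\<lambda>k. X k \<omega>"] by simp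
          then show ?thesis using tail[of m] tail[of n] m True by (simp add: abs_real_def split: if_splits)
        qed (use eps in simp)
      qed
    qed
    then show "summable (\<lambda>k. X k \<omega>)" unfolding summable_Cauchy by blast
  qed
qed

text \<open>Fatou suffices since only the upper bound for the second moment is needed.\<close>

lemma (in prob_space) random_series_second_moment:
  fixes \<xi> :: "nat \<Rightarrow> 'a \<Rightarrow> real"
  assumes indep: "indep_vars (\<lambda>_. borel) \<xi> UNIV"
    and sq: "\<And>k. integrable M (\<lambda>\<omega>. (\<xi> k \<omega>)\<^sup>2)"
    and mean: "\<And>k. expectation (\<xi> k) = 0"
    and var: "\<And>k. expectation (\<lambda>\<omega>. (\<xi> k \<omega>)\<^sup>2) = h"
    and a: "summable (\<lambda>k. (a k)\<^sup>2)"
  shows "AE \<omega> in M. summable (\<lambda>k. \<xi> k \<omega> * a k)"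
    and "(\<integral>\<^sup>+\<omega>. ennreal ((v + (\<Sum>k. \<xi> k \<omega> * a k))\<^sup>2) \<partial>M) \<le> ennreal (v\<^sup>2 + h * (\<Sum>k. (a k)\<^sup>2))"
proof -
  define X where "X k \<omega> = \<xi> k \<omega> * a k" for k \<omega>
  have [measurable]: "\<xi> k \<in> borel_measurable M" for k
    using indep unfolding indep_vars_def by auto
  have h0: "0 \<le> h" using var[of 0] by (metis Bochner_Integration.integral_nonneg zero_le_power2)
  have iX: "indep_vars (\<lambda>_. borel) X UNIV"
    unfolding X_def by (rule indep_vars_compose2[OF indep]) auto
  have sX: "integrable M (\<lambda>\<omega>. (X k \<omega>)\<^sup>2)" for k
    by (simp add: X_def power_mult_distrib sq)
  have mX: "expectation (X k) = 0" for k
    by (simp add: X_def[abs_def] mean)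
  have vX: "expectation (\<lambda>\<omega>. (X k \<omega>)\<^sup>2) = h * (a k)\<^sup>2" for k
    by (simp add: X_def power_mult_distrib var)
  have ae: "AE \<omega> in M. summable (\<lambda>k. X k \<omega>)"
    by (rule AE_summable_if_summable_variance[OF iX sX mX]) (simp add: vX a summable_mult)
  then show "AE \<omega> in M. summable (\<lambda>k. \<xi> k \<omega> * a k)" by (simp add: X_def)
  have fin: "(\<integral>\<^sup>+\<omega>. ennreal ((v + (\<Sum>k<N. X k \<omega>))\<^sup>2) \<partial>M) \<le> ennreal (v\<^sup>2 + h * (\<Sum>k. (a k)\<^sup>2))" for N
  proof -
    note mom = predictable_sum_second_moment[OF iX sX mX, of "\<lambda>_ _. 1" v N, simplified]
    have "(\<integral>\<^sup>+\<omega>. ennreal ((v + (\<Sum>k<N. X k \<omega>))\<^sup>2) \<partial>M) = ennreal (expectation (\<lambda>\<omega>. (v + (\<Sum>k<N. X k \<omega>))\<^sup>2))"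
      by (rule nn_integral_eq_integral[OF mom(1)]) simp
    also have "\<dots> \<le> ennreal (v\<^sup>2 + (\<Sum>k<N. h * (a k)\<^sup>2))"
      using mom(2) by (intro ennreal_leI) (simp add: vX)
    also have "\<dots> \<le> ennreal (v\<^sup>2 + h * (\<Sum>k. (a k)\<^sup>2))"
      unfolding sum_distrib_left[symmetric]
      by (intro ennreal_leI add_left_mono mult_left_mono h0 sum_le_suminf a) auto
    finally show ?thesis .
  qed
  have "(\<integral>\<^sup>+\<omega>. ennreal ((v + (\<Sum>k. X k \<omega>))\<^sup>2) \<partial>M) =
      (\<integral>\<^sup>+\<omega>. liminf (\<lambda>N. ennreal ((v + (\<Sum>k<N. X k \<omega>))\<^sup>2)) \<partial>M)"
  proof (rule nn_integral_cong_AE, rule AE_mp[OF ae], intro AE_I2 impI)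
    fix \<omega> assume "summable (\<lambda>k. X k \<omega>)"
    then have "(\<lambda>N. ennreal ((v + (\<Sum>k<N. X k \<omega>))\<^sup>2)) \<longlonglongrightarrow> ennreal ((v + (\<Sum>k. X k \<omega>))\<^sup>2)"
      by (intro tendsto_ennrealI tendsto_power tendsto_add tendsto_const summable_LIMSEQ)
    then show "ennreal ((v + (\<Sum>k. X k \<omega>))\<^sup>2) = liminf (\<lambda>N. ennreal ((v + (\<Sum>k<N. X k \<omega>))\<^sup>2))"
      by (intro lim_imp_Liminf[symmetric]) auto
  qed
  also have "\<dots> \<le> liminf (\<lambda>N. \<integral>\<^sup>+\<omega>. ennreal ((v + (\<Sum>k<N. X k \<omega>))\<^sup>2) \<partial>M)"
    unfolding X_def by (rule nn_integral_liminf) measurable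
  also have "\<dots> \<le> ennreal (v\<^sup>2 + h * (\<Sum>k. (a k)\<^sup>2))"
    using fin by (intro Liminf_le) auto
  finally show "(\<integral>\<^sup>+\<omega>. ennreal ((v + (\<Sum>k. \<xi> k \<omega> * a k))\<^sup>2) \<partial>M) \<le> ennreal (v\<^sup>2 + h * (\<Sum>k. (a k)\<^sup>2))"
    by (simp add: X_def)
qed

text \<open>The freezing argument that stands in for conditional expectation: the joint law is a
  product measure, so the past \<open>C\<close> is held fixed while the fresh noise \<open>Z\<close>
  is averaged.\<close>

lemma (in prob_space) indep_var_nn_integral_Fubini:
  assumes ind: "indep_var S C T Z"
    and f: "(\<lambda>(c, z). f c z) \<in> borel_measurable (S \<Otimes>\<^sub>M T)"
  shows "(\<integral>\<^sup>+\<omega>. f (C \<omega>) (Z \<omega>) \<partial>M) = (\<integral>\<^sup>+\<omega>. (\<integral>\<^sup>+\<omega>'. f (C \<omega>) (Z \<omega>') \<partial>M) \<partial>M)"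
proof -
  have C[measurable]: "C \<in> measurable M S" and Z[measurable]: "Z \<in> measurable M T"
    and eq: "distr M S C \<Otimes>\<^sub>M distr M T Z = distr M (S \<Otimes>\<^sub>M T) (\<lambda>x. (C x, Z x))"
    using ind unfolding indep_var_distribution_eq by auto
  interpret Z: prob_space "distr M T Z" by (rule prob_space_distr[OF Z])
  have f'[measurable]: "(\<lambda>(c, z). f c z) \<in> borel_measurable (S \<Otimes>\<^sub>M distr M T Z)"
    using f by (simp cong: measurable_cong_sets sets_pair_measure_cong)
  have "(\<integral>\<^sup>+\<omega>. f (C \<omega>) (Z \<omega>) \<partial>M) = (\<integral>\<^sup>+x. (\<lambda>(c, z). f c z) x \<partial>(distr M S C \<Otimes>\<^sub>M distr M T Z))"
    unfolding eq using f by (subst nn_integral_distr) auto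
  also have "\<dots> = (\<integral>\<^sup>+c. (\<integral>\<^sup>+z. f c z \<partial>distr M T Z) \<partial>distr M S C)"
    using f by (subst Z.nn_integral_fst[symmetric]) (auto cong: measurable_cong_sets sets_pair_measure_cong)
  also have "\<dots> = (\<integral>\<^sup>+\<omega>. (\<integral>\<^sup>+z. f (C \<omega>) z \<partial>distr M T Z) \<partial>M)"
    using Z.borel_measurable_nn_integral[OF f'] by (intro nn_integral_distr) auto
  also have "\<dots> = (\<integral>\<^sup>+\<omega>. (\<integral>\<^sup>+\<omega>'. f (C \<omega>) (Z \<omega>') \<partial>M) \<partial>M)"
  proof (intro nn_integral_cong nn_integral_distr Z)
    fix \<omega> assume "\<omega> \<in> space M"
    then have "C \<omega> \<in> space S" using measurable_space[OF C] by auto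
    from measurable_compose[OF measurable_Pair1'[OF this] f] show "f (C \<omega>) \<in> borel_measurable (distr M T Z)"
      by simp
  qed
  finally show ?thesis .
qed

subsection \<open>Coordinates in the eigenbasis\<close>

locale orthonormal_sequence =
  fixes e :: "nat \<Rightarrow> 'h::real_inner"
  assumes orthonormal: "e i \<bullet> e j = (if i = j then 1 else 0)"
begin

text \<open>Points of the span of the first \<open>n\<close> eigenvectors are handled through real
  coordinate sequences, so that measurability and independence become coordinatewise. Entries from
  index \<open>n\<close> on are ignored.\<close>

definition emb :: "nat \<Rightarrow> (nat \<Rightarrow> real) \<Rightarrow> 'h" where
  "emb n c = (\<Sum>i<n. c i *\<^sub>R e i)"

lemma emb_inner: "emb n c \<bullet> e i = (if i < n then c i else 0)"
  by (simp add: emb_def inner_sum_left orthonormal if_distrib cong: if_cong)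

lemma norm_emb: "(norm (emb n c))\<^sup>2 = (\<Sum>i<n. (c i)\<^sup>2)"
proof -
  have "(norm (emb n c))\<^sup>2 = (\<Sum>i<n. c i * (emb n c \<bullet> e i))"
    unfolding power2_norm_eq_inner by (subst (2) emb_def) (simp add: inner_sum_right)
  also have "\<dots> = (\<Sum>i<n. (c i)\<^sup>2)"
    by (intro sum.cong) (auto simp: emb_inner power2_eq_square)
  finally show ?thesis .
qed

lemma Bessel: "(\<Sum>i<n. (v \<bullet> e i)\<^sup>2) \<le> (norm v)\<^sup>2"
proof -
  let ?p = "emb n (\<lambda>i. v \<bullet> e i)"
  have "v \<bullet> ?p = (\<Sum>i<n. (v \<bullet> e i)\<^sup>2)"
    by (simp add: emb_def inner_sum_right power2_eq_square)
  moreover have "0 \<le> (norm (v - ?p))\<^sup>2" by simp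
  ultimately show ?thesis
    using norm_emb[of n "\<lambda>i. v \<bullet> e i"]
    by (simp add: power2_norm_eq_inner inner_diff inner_commute)
qed

lemma emb_in_span: "emb n c \<in> span (e ` {..<n})"
  unfolding emb_def by (intro span_sum span_scale span_base) auto

lemma emb_coords:
  assumes "v \<in> span (e ` {..<n})"
  shows "emb n (\<lambda>i. v \<bullet> e i) = v"
  using assms
proof (induction rule: span_induct_alt)
  case base
  then show ?case by (simp add: emb_def)
next
  case (step c x y)
  then obtain j where j: "j < n" "x = e j" by auto
  have "emb n (\<lambda>i. x \<bullet> e i) = x"
    using j by (simp add: emb_def orthonormal if_distrib[of "\<lambda>r. r *\<^sub>R _"] cong: if_cong)
  moreover have "emb n (\<lambda>i. (c *\<^sub>R x + y) \<bullet> e i) = c *\<^sub>R emb n (\<lambda>i. x \<bullet> e i) + emb n (\<lambda>i. y \<bullet> e i)"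
    by (simp add: emb_def inner_add_left scaleR_left_distrib sum.distrib scaleR_sum_right)
  ultimately show ?case using step by simp
qed

lemma emb_add: "emb n c + emb n d = emb n (\<lambda>i. c i + d i)"
  by (simp add: emb_def scaleR_left_distrib sum.distrib)

lemma emb_diff: "emb n c - emb n d = emb n (\<lambda>i. c i - d i)"
  by (simp add: emb_def scaleR_left_diff_distrib sum_subtractf)

lemma emb_scaleR: "r *\<^sub>R emb n c = emb n (\<lambda>i. r * c i)"
  by (simp add: emb_def scaleR_sum_right)

lemma emb_sum: "(\<Sum>j\<in>J. emb n (c j)) = emb n (\<lambda>i. \<Sum>j\<in>J. c j i)"
  unfolding emb_def by (subst sum.swap) (simp add: scaleR_sum_left)

lemma continuous_on_emb: "continuous_on UNIV (emb n)"
  unfolding emb_def by (intro continuous_intros continuous_on_product_coordinates)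

lemma proj_eq_emb: "proj e n v = emb n (\<lambda>i. v \<bullet> e i)"
  by (simp add: proj_def emb_def)

lemma noise_incr_eq_emb:
  "noise_incr e n S \<beta> s t \<omega> = emb n (\<lambda>i. \<Sum>k. (\<beta> k t \<omega> - \<beta> k s \<omega>) * (S (e k) \<bullet> e i))"
  by (simp add: noise_incr_def emb_def)

lemma semigrp_emb: "semigrp e lam t (emb n c) = emb n (\<lambda>i. exp (- lam i * t) * c i)"
proof -
  have "semigrp e lam t (emb n c) = (\<Sum>i<n. (exp (- lam i * t) * (emb n c \<bullet> e i)) *\<^sub>R e i)"
    unfolding semigrp_def by (rule suminf_finite) (auto simp: emb_inner)
  then show ?thesis unfolding emb_def[of n "\<lambda>i. exp (- lam i * t) * c i"]
    by (simp add: emb_inner)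
qed

text \<open>This avoids the adjoint of \<^term>\<open>S\<close>: with
  \<^term>\<open>u = emb N (\<lambda>k. blinfun_apply S (e k) \<bullet> e i)\<close> the partial sum
  equals both the inner product of \<^term>\<open>S u\<close> with \<^term>\<open>e i\<close> and the squared norm of \<^term>\<open>u\<close>.\<close>

lemma summable_blinfun_row: "summable (\<lambda>k. (blinfun_apply S (e k) \<bullet> e i)\<^sup>2)"
proof (rule bounded_imp_summable)
  fix N
  define u where "u = emb (Suc N) (\<lambda>k. blinfun_apply S (e k) \<bullet> e i)"
  have "(norm u)\<^sup>2 = blinfun_apply S u \<bullet> e i"
    unfolding u_def norm_emb
    by (simp add: emb_def blinfun.sum_right blinfun.scaleR_right inner_sum_left power2_eq_square
        del: sum.lessThan_Suc)
  also have "\<dots> \<le> norm (blinfun_apply S u) * norm (e i)" by (rule norm_cauchy_schwarz)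
  also have "\<dots> \<le> norm S * norm u"
    by (simp add: norm_eq_sqrt_inner[of "e i"] orthonormal norm_blinfun)
  finally have "norm u \<le> norm S"
    by (cases "u = 0") (auto simp: power2_eq_square)
  then have "(norm u)\<^sup>2 \<le> (norm S)\<^sup>2" by (intro power_mono) auto
  then show "(\<Sum>k\<le>N. (blinfun_apply S (e k) \<bullet> e i)\<^sup>2) \<le> (norm S)\<^sup>2"
    unfolding u_def norm_emb lessThan_Suc_atMost .
qed simp

lemma hs_sq_finite:
  assumes "hs_sq e D < \<infinity>"
  shows "summable (\<lambda>k. (norm (D (e k)))\<^sup>2)" and "enn2real (hs_sq e D) = (\<Sum>k. (norm (D (e k)))\<^sup>2)"
proof -
  show s: "summable (\<lambda>k. (norm (D (e k)))\<^sup>2)"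
    using assms unfolding hs_sq_def by (intro summable_suminf_not_top) auto
  show "enn2real (hs_sq e D) = (\<Sum>k. (norm (D (e k)))\<^sup>2)"
    unfolding hs_sq_def by (subst suminf_ennreal2) (simp_all add: s suminf_nonneg)
qed

lemma norm_apply_le_hs:
  assumes "hs_sq e D < \<infinity>"
  shows "(norm (D (e k)))\<^sup>2 \<le> enn2real (hs_sq e D)"
  unfolding hs_sq_finite(2)[OF assms]
  using sum_le_suminf[OF hs_sq_finite(1)[OF assms], of "{k}"] by simp

text \<open>After exchanging the sums, Bessel's inequality applies to each column
  \<open>D (e k)\<close>.\<close>

lemma sum_rows_le_hs:
  assumes fin: "hs_sq e (blinfun_apply D) < \<infinity>"
  shows "(\<Sum>i<n. \<Sum>k. (blinfun_apply D (e k) \<bullet> e i)\<^sup>2) \<le> enn2real (hs_sq e (blinfun_apply D))"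
proof -
  have "(\<Sum>i<n. \<Sum>k. (blinfun_apply D (e k) \<bullet> e i)\<^sup>2) = (\<Sum>k. \<Sum>i<n. (blinfun_apply D (e k) \<bullet> e i)\<^sup>2)"
    by (rule suminf_sum[symmetric]) (rule summable_blinfun_row)
  also have "\<dots> \<le> (\<Sum>k. (norm (blinfun_apply D (e k)))\<^sup>2)"
    by (intro suminf_le Bessel hs_sq_finite(1)[OF fin] summable_sum summable_blinfun_row)
  finally show ?thesis by (simp add: hs_sq_finite(2)[OF fin])
qed

text \<open>The semigroup law: the factor for the last \<open>h\<close> time units splits off every
  earlier contribution, turning the sum over the whole past into a one-step recursion. All vectors
  lie in the span of the first \<open>n\<close> eigenvectors, so this is checked per
  coordinate.\<close>

lemma EI_rhs_step:
  assumes x: "x \<in> span (e ` {..<n})" and h: "0 < h" "h \<le> \<Delta>"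
  shows "EI_rhs e lam n \<Delta> b \<sigma> \<beta> x Y (real j * \<Delta> + h) \<omega> =
    semigrp e lam h (EI_rhs e lam n \<Delta> b \<sigma> \<beta> x Y (real j * \<Delta>) \<omega>
      + (h *\<^sub>R proj e n (b (Y (real j * \<Delta>) \<omega>))
         + noise_incr e n (\<sigma> (Y (real j * \<Delta>) \<omega>)) \<beta> (real j * \<Delta>) (real j * \<Delta> + h) \<omega>))"
proof -
  let ?t = "real j * \<Delta> + h"
  \<comment> \<open>Coordinate \<open>l\<close> of what step \<open>i\<close> has contributed up to
    time \<open>t\<close>, before damping by the semigroup.\<close>
  define c where "c t i l = (min t (real (Suc i) * \<Delta>) - real i * \<Delta>) * (b (Y (real i * \<Delta>) \<omega>) \<bullet> e l)
      + (\<Sum>k. (\<beta> k (min t (real (Suc i) * \<Delta>)) \<omega> - \<beta> k (real i * \<Delta>) \<omega>) * (\<sigma> (Y (real i * \<Delta>) \<omega>) (e k) \<bullet> e l))"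
    for t i l
  define x' where "x' l = x \<bullet> e l" for l
  have x': "x = emb n x'" using emb_coords[OF x] by (simp add: x'_def[abs_def])
  have \<Delta>: "0 < \<Delta>" using h by simp
  \<comment> \<open>As the index condition is strict, step \<open>j\<close> counts at time
    \<open>j * \<Delta> + h\<close> but not at \<open>j * \<Delta>\<close>, and step
    \<open>j + 1\<close> has not begun even for \<open>h = \<Delta>\<close>.\<close>
  have idx1: "{i. real i * \<Delta> < ?t} = insert j {..<j}"
  proof -
    have "real i * \<Delta> < ?t \<longleftrightarrow> i \<le> j" for i
    proof
      assume "real i * \<Delta> < ?t"
      then have "real i * \<Delta> < real (Suc j) * \<Delta>" using h(2) by (simp add: ring_distribs)
      then show "i \<le> j" using \<Delta> by (simp only: mult_less_cancel_right_pos of_nat_less_iff less_Suc_eq_le)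
    next
      assume "i \<le> j"
      then have "real i * \<Delta> \<le> real j * \<Delta>" using \<Delta> by simp
      with h(1) show "real i * \<Delta> < ?t" by linarith
    qed
    then have "{i. real i * \<Delta> < ?t} = {i. i \<le> j}" by (simp only:)
    also have "\<dots> = insert j {..<j}" by auto
    finally show ?thesis .
  qed
  have idx2: "{i. real i * \<Delta> < real j * \<Delta>} = {..<j}" using \<Delta> by (simp add: lessThan_def)
  \<comment> \<open>A completed step no longer depends on the time of observation, because both
    minima select its right end point.\<close>
  have cc: "c ?t i = c (real j * \<Delta>) i" if "i < j" for i
  proof -
    have "real (Suc i) * \<Delta> \<le> real j * \<Delta>" using that \<Delta> by (intro mult_right_mono) auto
    then have "min ?t (real (Suc i) * \<Delta>) = real (Suc i) * \<Delta>"
      "min (real j * \<Delta>) (real (Suc i) * \<Delta>) = real (Suc i) * \<Delta>" using h by linarith+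
    then show ?thesis unfolding c_def by simp
  qed
  have mj: "min ?t (real (Suc j) * \<Delta>) = ?t" using h by (simp add: algebra_simps)
  have cj: "c ?t j l = h * (b (Y (real j * \<Delta>) \<omega>) \<bullet> e l)
      + (\<Sum>k. (\<beta> k ?t \<omega> - \<beta> k (real j * \<Delta>) \<omega>) * (\<sigma> (Y (real j * \<Delta>) \<omega>) (e k) \<bullet> e l))" for l
    unfolding c_def mj by simp
  have rhs: "EI_rhs e lam n \<Delta> b \<sigma> \<beta> x Y t \<omega> = emb n (\<lambda>l. exp (- lam l * t) * x' l
     + (\<Sum>i\<in>{i. real i * \<Delta> < t}. exp (- lam l * (t - real i * \<Delta>)) * c t i l))" for t
    unfolding EI_rhs_def x' proj_eq_emb noise_incr_eq_emb emb_scaleR emb_add semigrp_emb emb_sum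
    by (simp add: c_def)
  have "exp (- lam l * ?t) * x' l + (\<Sum>i\<in>insert j {..<j}. exp (- lam l * (?t - real i * \<Delta>)) * c ?t i l)
     = exp (- lam l * h) * (exp (- lam l * (real j * \<Delta>)) * x' l
         + (\<Sum>i<j. exp (- lam l * (real j * \<Delta> - real i * \<Delta>)) * c (real j * \<Delta>) i l) + c ?t j l)" for l
  proof -
    have e: "exp (- lam l * (?t - s)) = exp (- lam l * h) * exp (- lam l * (real j * \<Delta> - s))" for s
      by (simp add: exp_add[symmetric] algebra_simps)
    have "(\<Sum>i<j. exp (- lam l * (?t - real i * \<Delta>)) * c ?t i l)
       = exp (- lam l * h) * (\<Sum>i<j. exp (- lam l * (real j * \<Delta> - real i * \<Delta>)) * c (real j * \<Delta>) i l)"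
      unfolding sum_distrib_left e by (intro sum.cong refl) (simp add: cc)
    then show ?thesis using e[of 0] e[of "real j * \<Delta>"] by (simp add: algebra_simps)
  qed
  then show ?thesis
    unfolding rhs idx1 idx2 proj_eq_emb noise_incr_eq_emb emb_scaleR emb_add semigrp_emb
    by (simp add: cj add.assoc)
qed

end

subsection \<open>The exponential integrator as a Markov chain\<close>

text \<open>Continuity of the coefficients provides Borel measurability of the one-step map.\<close>

locale EI_scheme = orthonormal_sequence e
  for e :: "nat \<Rightarrow> 'h::real_inner" +
  fixes lam :: "nat \<Rightarrow> real" and n :: nat and b :: "'h \<Rightarrow> 'h" and \<sigma> :: "'h \<Rightarrow> ('h \<Rightarrow>\<^sub>L 'h)"
  assumes b_cont: "continuous_on UNIV b"
    and \<sigma>_cont: "continuous_on UNIV (\<lambda>y. blinfun_apply (\<sigma> y) (e k))"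
begin

text \<open>The length \<open>h\<close> is a parameter because the same map serves full steps and
  the partial step to a time between grid points. The noise series is a total term; its almost sure
  convergence is established where the map is estimated.\<close>

definition EI_step :: "real \<Rightarrow> (nat \<Rightarrow> real) \<Rightarrow> (nat \<Rightarrow> real) \<Rightarrow> nat \<Rightarrow> real" where
  "EI_step h c z i = exp (- lam i * h) * (c i + h * (b (emb n c) \<bullet> e i)
     + (\<Sum>k. z k * (blinfun_apply (\<sigma> (emb n c)) (e k) \<bullet> e i)))"

text \<open>\<^term>\<open>w (k, j)\<close> is the increment of the \<^term>\<open>k\<close>-th Brownian motion over the \<^term>\<open>j\<close>-th step.\<close>

primrec EI_chain :: "real \<Rightarrow> (nat \<Rightarrow> real) \<Rightarrow> nat \<Rightarrow> (nat \<times> nat \<Rightarrow> real) \<Rightarrow> nat \<Rightarrow> real" where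
  "EI_chain h c 0 w = c"
| "EI_chain h c (Suc j) w = EI_step h (EI_chain h c j w) (\<lambda>k. w (k, j))"

lemma EI_step_measurable [measurable (raw)]:
  assumes [measurable]: "c \<in> borel_measurable N" "z \<in> borel_measurable N"
  shows "(\<lambda>x. EI_step h (c x) (z x)) \<in> borel_measurable N"
proof (rule measurable_coordinatewise_then_product)
  fix i
  have [measurable]: "(\<lambda>c. b (emb n c) \<bullet> e i) \<in> borel_measurable borel"
    by (intro borel_measurable_continuous_onI continuous_intros continuous_on_compose2[OF b_cont continuous_on_emb]) auto
  have [measurable]: "(\<lambda>c. blinfun_apply (\<sigma> (emb n c)) (e k) \<bullet> e i) \<in> borel_measurable borel" for k
    by (intro borel_measurable_continuous_onI continuous_intros continuous_on_compose2[OF \<sigma>_cont continuous_on_emb]) auto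
  have [measurable]: "(\<lambda>x. c x k) \<in> borel_measurable N" "(\<lambda>x. z x k) \<in> borel_measurable N" for k
    using assms by (auto intro: measurable_product_then_coordinatewise)
  show "(\<lambda>x. EI_step h (c x) (z x) i) \<in> borel_measurable N"
    unfolding EI_step_def by measurable
qed

text \<open>Adaptedness: as a function of the increments before step \<open>j\<close>, the chain
  will be independent of the noise in that step.\<close>

lemma EI_chain_measurable:
  assumes "\<And>k i. i < j \<Longrightarrow> (\<lambda>x. w x (k, i)) \<in> borel_measurable N"
  shows "(\<lambda>x. EI_chain h c j (w x)) \<in> borel_measurable N"
  using assms
proof (induction j)
  case (Suc j)
  have "(\<lambda>x k. w x (k, j)) \<in> borel_measurable N"
    by (rule measurable_coordinatewise_then_product) (rule Suc.prems, simp)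
  moreover have "(\<lambda>x. EI_chain h c j (w x)) \<in> borel_measurable N"
    using Suc by simp
  ultimately show ?case by simp
qed simp

lemma EI_chain_cong:
  assumes "\<And>k i. i < j \<Longrightarrow> w (k, i) = w' (k, i)"
  shows "EI_chain h c j w = EI_chain h c j w'"
  using assms by (induction j) simp_all

lemma semigrp_EI_step:
  "semigrp e lam h (emb n c + (h *\<^sub>R proj e n (b (emb n c)) + noise_incr e n (blinfun_apply (\<sigma> (emb n c))) \<beta> s t \<omega>))
     = emb n (EI_step h c (\<lambda>k. \<beta> k t \<omega> - \<beta> k s \<omega>))"
  unfolding proj_eq_emb noise_incr_eq_emb emb_scaleR emb_add semigrp_emb
  by (simp add: EI_step_def[abs_def] add.assoc)

text \<open>With the past \<open>P\<close> frozen, each coordinate of the difference is a damping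
  factor times a constant plus a centred random series. Second moments add up over the coordinates;
  Bessel and the row bound bring in the full norms, to which \<open>diss\<close> applies.
  \<open>E\<close> bounds the damping, \<open>K\<close> the growth from drift and noise.\<close>

lemma EI_step_mean_square:
  fixes P Q :: "'w \<Rightarrow> 'c" and c\<^sub>1 c\<^sub>2 \<zeta> :: "'c \<Rightarrow> nat \<Rightarrow> real"
  assumes M: "prob_space M"
    and ind: "prob_space.indep_var M S P T Q"
    and c: "c\<^sub>1 \<in> borel_measurable S" "c\<^sub>2 \<in> borel_measurable S" and \<zeta>: "\<zeta> \<in> borel_measurable T"
    and indZ: "prob_space.indep_vars M (\<lambda>_. borel) (\<lambda>k \<omega>. \<zeta> (Q \<omega>) k) UNIV"
    and sq: "\<And>k. integrable M (\<lambda>\<omega>. (\<zeta> (Q \<omega>) k)\<^sup>2)"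
    and mean: "\<And>k. (\<integral>\<omega>. \<zeta> (Q \<omega>) k \<partial>M) = 0"
    and var: "\<And>k. (\<integral>\<omega>. (\<zeta> (Q \<omega>) k)\<^sup>2 \<partial>M) = h"
    and h: "0 \<le> h"
    and contr: "\<And>i. i < n \<Longrightarrow> (exp (- lam i * h))\<^sup>2 \<le> E"
    and hs: "\<And>u v. hs_sq e (blinfun_apply (\<sigma> u - \<sigma> v)) < \<infinity>"
    and diss: "\<And>u v. (norm (u - v + h *\<^sub>R (b u - b v)))\<^sup>2 + h * enn2real (hs_sq e (blinfun_apply (\<sigma> u - \<sigma> v)))
       \<le> K * (norm (u - v))\<^sup>2"
    and E: "0 \<le> E"
  shows "(\<integral>\<^sup>+\<omega>. ennreal ((norm (emb n (EI_step h (c\<^sub>1 (P \<omega>)) (\<zeta> (Q \<omega>)))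
        - emb n (EI_step h (c\<^sub>2 (P \<omega>)) (\<zeta> (Q \<omega>)))))\<^sup>2) \<partial>M)
     \<le> ennreal (E * K) * (\<integral>\<^sup>+\<omega>. ennreal ((norm (emb n (c\<^sub>1 (P \<omega>)) - emb n (c\<^sub>2 (P \<omega>))))\<^sup>2) \<partial>M)"
proof -
  interpret prob_space M by (rule M)
  note [measurable] = c \<zeta>
  have Pm[measurable]: "P \<in> measurable M S" and Qm[measurable]: "Q \<in> measurable M T"
    using ind by (auto dest: indep_var_rv1 indep_var_rv2)
  define Z where "Z \<omega> = \<zeta> (Q \<omega>)" for \<omega>
  note indZ = indZ[folded Z_def] and sq = sq[folded Z_def] and mean = mean[folded Z_def] and var = var[folded Z_def]
  have [measurable]: "(\<lambda>\<omega>. Z \<omega> k) \<in> borel_measurable M" for k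
    using indZ unfolding indep_vars_def by auto
  have norm_diff_measurable: "(\<lambda>x. ennreal ((norm (emb n (f x) - emb n (g x)))\<^sup>2)) \<in> borel_measurable N"
    if "f \<in> borel_measurable N" "g \<in> borel_measurable N" for N :: "'z measure" and f g
  proof -
    have [measurable]: "(\<lambda>x. f x k) \<in> borel_measurable N" "(\<lambda>x. g x k) \<in> borel_measurable N" for k
      using that by (auto intro: measurable_product_then_coordinatewise)
    show ?thesis unfolding emb_diff norm_emb by measurable
  qed
  define F where "F c z = ennreal ((norm (emb n (EI_step h (fst c) z) - emb n (EI_step h (snd c) z)))\<^sup>2)"
    for c :: "(nat \<Rightarrow> real) \<times> (nat \<Rightarrow> real)" and z
  have Fm: "(\<lambda>(p, q). F (c\<^sub>1 p, c\<^sub>2 p) (\<zeta> q)) \<in> borel_measurable (S \<Otimes>\<^sub>M T)"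
    unfolding F_def case_prod_beta fst_conv snd_conv by (intro norm_diff_measurable) measurable
  have inner: "(\<integral>\<^sup>+\<omega>. F (c, d) (Z \<omega>) \<partial>M) \<le> ennreal (E * K) * ennreal ((norm (emb n c - emb n d))\<^sup>2)" for c d
  proof -
    define u v where "u = emb n c" and "v = emb n d"
    define S where "S = \<sigma> u - \<sigma> v"
    define a where "a i k = blinfun_apply S (e k) \<bullet> e i" for i k
    define D where "D = u - v + h *\<^sub>R (b u - b v)"
    have sa: "summable (\<lambda>k. (a i k)\<^sup>2)" for i unfolding a_def by (rule summable_blinfun_row)
    note series = random_series_second_moment[OF indZ sq mean var]
    \<comment> \<open>Both noise series must converge separately before their difference becomes the
      series with coefficients \<open>a\<close>. Boundedness of each operator makes its rows square
      summable.\<close>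
    have "AE \<omega> in M. summable (\<lambda>k. Z \<omega> k * (blinfun_apply (\<sigma> w) (e k) \<bullet> e i))" for w i
      by (rule series(1)) (rule summable_blinfun_row)
    then have ae: "AE \<omega> in M. \<forall>i. summable (\<lambda>k. Z \<omega> k * (blinfun_apply (\<sigma> u) (e k) \<bullet> e i))
        \<and> summable (\<lambda>k. Z \<omega> k * (blinfun_apply (\<sigma> v) (e k) \<bullet> e i))"
      by (simp add: AE_all_countable)
    have "(\<integral>\<^sup>+\<omega>. F (c, d) (Z \<omega>) \<partial>M) \<le>
       (\<integral>\<^sup>+\<omega>. (\<Sum>i<n. ennreal E * ennreal ((D \<bullet> e i + (\<Sum>k. Z \<omega> k * a i k))\<^sup>2)) \<partial>M)"
    proof (rule nn_integral_mono_AE, rule AE_mp[OF ae], intro AE_I2 impI)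
      fix \<omega>
      assume s: "\<forall>i. summable (\<lambda>k. Z \<omega> k * (blinfun_apply (\<sigma> u) (e k) \<bullet> e i))
        \<and> summable (\<lambda>k. Z \<omega> k * (blinfun_apply (\<sigma> v) (e k) \<bullet> e i))"
      have "EI_step h c (Z \<omega>) i - EI_step h d (Z \<omega>) i =
          exp (- lam i * h) * (D \<bullet> e i + (\<Sum>k. Z \<omega> k * a i k))" if "i < n" for i
      proof -
        have diff: "(\<Sum>k. Z \<omega> k * a i k) = (\<Sum>k. Z \<omega> k * (blinfun_apply (\<sigma> u) (e k) \<bullet> e i))
            - (\<Sum>k. Z \<omega> k * (blinfun_apply (\<sigma> v) (e k) \<bullet> e i))"
          using s by (subst suminf_diff)
            (auto simp: a_def S_def blinfun.diff_left inner_diff_left right_diff_distrib)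
        have "u \<bullet> e i = c i" "v \<bullet> e i = d i"
          using that by (simp_all add: u_def v_def emb_inner)
        then show ?thesis
          unfolding EI_step_def u_def[symmetric] v_def[symmetric] diff
          by (simp add: D_def inner_add_left inner_diff_left algebra_simps)
      qed
      then have "(norm (emb n (EI_step h c (Z \<omega>)) - emb n (EI_step h d (Z \<omega>))))\<^sup>2
         = (\<Sum>i<n. (exp (- lam i * h))\<^sup>2 * (D \<bullet> e i + (\<Sum>k. Z \<omega> k * a i k))\<^sup>2)"
        unfolding emb_diff norm_emb by (intro sum.cong) (auto simp: power_mult_distrib)
      also have "\<dots> \<le> (\<Sum>i<n. E * (D \<bullet> e i + (\<Sum>k. Z \<omega> k * a i k))\<^sup>2)"
        by (intro sum_mono mult_right_mono contr) auto
      finally have "F (c, d) (Z \<omega>) \<le> ennreal (\<Sum>i<n. E * (D \<bullet> e i + (\<Sum>k. Z \<omega> k * a i k))\<^sup>2)"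
        by (simp add: F_def ennreal_leI)
      also have "\<dots> = (\<Sum>i<n. ennreal E * ennreal ((D \<bullet> e i + (\<Sum>k. Z \<omega> k * a i k))\<^sup>2))"
        using E by (simp add: sum_ennreal[symmetric] ennreal_mult)
      finally show "F (c, d) (Z \<omega>) \<le> \<dots>" .
    qed
    also have "\<dots> = (\<Sum>i<n. ennreal E * (\<integral>\<^sup>+\<omega>. ennreal ((D \<bullet> e i + (\<Sum>k. Z \<omega> k * a i k))\<^sup>2) \<partial>M))"
      by (simp add: nn_integral_sum nn_integral_cmult)
    also have "\<dots> \<le> (\<Sum>i<n. ennreal E * ennreal ((D \<bullet> e i)\<^sup>2 + h * (\<Sum>k. (a i k)\<^sup>2)))"
      by (intro sum_mono mult_left_mono series(2) sa) auto
    also have "\<dots> = ennreal E * ennreal (\<Sum>i<n. (D \<bullet> e i)\<^sup>2 + h * (\<Sum>k. (a i k)\<^sup>2))"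
      using h by (subst sum_ennreal[symmetric])
        (auto simp: sum_distrib_left intro!: add_nonneg_nonneg mult_nonneg_nonneg suminf_nonneg sa)
    also have "\<dots> \<le> ennreal E * ennreal (K * (norm (u - v))\<^sup>2)"
    proof (intro mult_left_mono ennreal_leI)
      have "(\<Sum>i<n. (D \<bullet> e i)\<^sup>2 + h * (\<Sum>k. (a i k)\<^sup>2)) = (\<Sum>i<n. (D \<bullet> e i)\<^sup>2) + h * (\<Sum>i<n. \<Sum>k. (a i k)\<^sup>2)"
        by (simp add: sum.distrib sum_distrib_left)
      also have "\<dots> \<le> (norm D)\<^sup>2 + h * enn2real (hs_sq e (blinfun_apply S))"
        unfolding a_def S_def by (intro add_mono mult_left_mono Bessel sum_rows_le_hs hs h)
      also have "\<dots> \<le> K * (norm (u - v))\<^sup>2" unfolding D_def S_def by (rule diss)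
      finally show "(\<Sum>i<n. (D \<bullet> e i)\<^sup>2 + h * (\<Sum>k. (a i k)\<^sup>2)) \<le> K * (norm (u - v))\<^sup>2" .
    qed simp
    also have "\<dots> = ennreal (E * K) * ennreal ((norm (u - v))\<^sup>2)"
      using E by (simp add: ennreal_mult'[symmetric] ennreal_mult''[symmetric] mult.assoc)
    finally show ?thesis by (simp add: u_def v_def)
  qed
  have "(\<integral>\<^sup>+\<omega>. F (c\<^sub>1 (P \<omega>), c\<^sub>2 (P \<omega>)) (\<zeta> (Q \<omega>)) \<partial>M)
      = (\<integral>\<^sup>+\<omega>. (\<integral>\<^sup>+\<omega>'. F (c\<^sub>1 (P \<omega>), c\<^sub>2 (P \<omega>)) (Z \<omega>') \<partial>M) \<partial>M)"
    unfolding Z_def by (rule indep_var_nn_integral_Fubini[OF ind Fm])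
  also have "\<dots> \<le> (\<integral>\<^sup>+\<omega>. ennreal (E * K) * ennreal ((norm (emb n (c\<^sub>1 (P \<omega>)) - emb n (c\<^sub>2 (P \<omega>))))\<^sup>2) \<partial>M)"
    by (intro nn_integral_mono inner)
  also have "\<dots> = ennreal (E * K) * (\<integral>\<^sup>+\<omega>. ennreal ((norm (emb n (c\<^sub>1 (P \<omega>)) - emb n (c\<^sub>2 (P \<omega>))))\<^sup>2) \<partial>M)"
    by (intro nn_integral_cmult norm_diff_measurable) measurable
  finally show ?thesis by (simp add: F_def)
qed

text \<open>The scheme holds almost surely at each fixed time. Only two times enter here, so their
  null sets can be combined.\<close>

lemma scheme_eq_EI_step:
  assumes x: "x \<in> span (e ` {..<n})" and h: "0 < h" "h \<le> \<Delta>"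
    and scheme: "\<forall>t\<ge>0. AE \<omega> in M.
        y t \<omega> = EI_rhs e lam n \<Delta> b (\<lambda>y. blinfun_apply (\<sigma> y)) \<beta> x y t \<omega>"
    and C: "AE \<omega> in M. y (real j * \<Delta>) \<omega> = emb n (C \<omega>)"
  shows "AE \<omega> in M. y (real j * \<Delta> + h) \<omega> =
    emb n (EI_step h (C \<omega>) (\<lambda>k. \<beta> k (real j * \<Delta> + h) \<omega> - \<beta> k (real j * \<Delta>) \<omega>))"
proof -
  have "AE \<omega> in M. y (real j * \<Delta> + h) \<omega> =
      EI_rhs e lam n \<Delta> b (\<lambda>y. blinfun_apply (\<sigma> y)) \<beta> x y (real j * \<Delta> + h) \<omega>"
    "AE \<omega> in M. y (real j * \<Delta>) \<omega> =
      EI_rhs e lam n \<Delta> b (\<lambda>y. blinfun_apply (\<sigma> y)) \<beta> x y (real j * \<Delta>) \<omega>"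
    using h by (auto intro!: scheme[rule_format])
  with C show ?thesis
  proof eventually_elim
    case (elim \<omega>)
    then show ?case
      using EI_rhs_step[OF x h, where j=j and Y=y, of lam b "\<lambda>y. blinfun_apply (\<sigma> y)" \<beta> \<omega>]
      by (simp add: semigrp_EI_step)
  qed
qed

text \<open>Identifies the solution at grid points, up to a null set, with an explicit function of
  past increments; this supplies its measurability and independence of later noise.\<close>

lemma scheme_eq_EI_chain:
  assumes x: "x \<in> span (e ` {..<n})" and \<Delta>: "0 < \<Delta>"
    and scheme: "\<forall>t\<ge>0. AE \<omega> in M.
        y t \<omega> = EI_rhs e lam n \<Delta> b (\<lambda>y. blinfun_apply (\<sigma> y)) \<beta> x y t \<omega>"
  shows "AE \<omega> in M. y (real j * \<Delta>) \<omega> = emb n (EI_chain \<Delta> (\<lambda>i. x \<bullet> e i) j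
    (\<lambda>(k, i). \<beta> k (real (Suc i) * \<Delta>) \<omega> - \<beta> k (real i * \<Delta>) \<omega>))"
proof (induction j)
  case 0
  have "{j. real j * \<Delta> < 0} = {}" using \<Delta> by (auto simp: mult_less_0_iff)
  moreover have "semigrp e lam 0 x = x"
    using semigrp_emb[of lam 0 n "\<lambda>i. x \<bullet> e i"] emb_coords[OF x] by simp
  ultimately show ?case
    using scheme[rule_format, of 0] emb_coords[OF x] by (simp add: EI_rhs_def)
next
  case (Suc j)
  then show ?case
    using scheme_eq_EI_step[OF x \<Delta> order_refl scheme Suc] by (simp add: algebra_simps)
qed

end

section \<open>Wiener increments on a time grid\<close>

lemma cyl_wiener_grid_indep:
  assumes "cyl_wiener M \<beta>" "0 \<le> \<tau> 0" "\<And>i. i < m \<Longrightarrow> \<tau> i < \<tau> (Suc i)"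
  shows "prob_space.indep_vars M (\<lambda>_. borel)
    (\<lambda>ki \<omega>. \<beta> (fst ki) (\<tau> (Suc (snd ki))) \<omega> - \<beta> (fst ki) (\<tau> (snd ki)) \<omega>) (UNIV \<times> {..<m})"
  using assms unfolding cyl_wiener_def by blast

lemma cyl_wiener_increment_moments:
  assumes W: "cyl_wiener M \<beta>" and st: "0 \<le> s" "s < t"
  shows "integrable M (\<lambda>\<omega>. (\<beta> k t \<omega> - \<beta> k s \<omega>)\<^sup>2)"
    and "(\<integral>\<omega>. (\<beta> k t \<omega> - \<beta> k s \<omega>) \<partial>M) = 0"
    and "(\<integral>\<omega>. (\<beta> k t \<omega> - \<beta> k s \<omega>)\<^sup>2 \<partial>M) = t - s"
proof -
  interpret prob_space M using W by (simp add: cyl_wiener_def)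
  \<comment> \<open>The two-point grid \<open>s < t\<close>, since Gaussian increments are
    prescribed on grids.\<close>
  define \<tau> where "\<tau> i = (if i = 0 then s else t)" for i :: nat
  have "0 \<le> \<tau> 0 \<and> (\<forall>i<1. \<tau> i < \<tau> (Suc i))" using st by (simp add: \<tau>_def)
  then have "\<forall>i<1. distributed M lborel (\<lambda>\<omega>. \<beta> k (\<tau> (Suc i)) \<omega> - \<beta> k (\<tau> i) \<omega>)
      (normal_density 0 (sqrt (\<tau> (Suc i) - \<tau> i)))"
    using W unfolding cyl_wiener_def by blast
  then have D: "distributed M lborel (\<lambda>\<omega>. \<beta> k t \<omega> - \<beta> k s \<omega>) (normal_density 0 (sqrt (t - s)))"
    by (simp add: \<tau>_def)
  have pos: "0 < sqrt (t - s)" using st by simp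
  show "integrable M (\<lambda>\<omega>. (\<beta> k t \<omega> - \<beta> k s \<omega>)\<^sup>2)"
  proof (rule distributed_integrable[OF D, THEN iffD1])
    show "integrable lborel (\<lambda>x. normal_density 0 (sqrt (t - s)) x * x\<^sup>2)"
      using integrable_normal_moment[OF pos, of 0 2] unfolding diff_0_right .
  qed auto
  show mean: "(\<integral>\<omega>. (\<beta> k t \<omega> - \<beta> k s \<omega>) \<partial>M) = 0"
    by (rule normal_distributed_expectation[OF pos D])
  show "(\<integral>\<omega>. (\<beta> k t \<omega> - \<beta> k s \<omega>)\<^sup>2 \<partial>M) = t - s"
    using normal_distributed_variance[OF pos D] st by (simp add: mean)
qed

context EI_scheme
begin

text \<open>The increments up to \<open>j * \<Delta>\<close> form the past \<open>P\<close> and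
  those over the last interval the noise \<open>Q\<close>; the abstract one-step estimate then
  carries over to the scheme by almost sure equality.\<close>

lemma scheme_mean_square_step:
  assumes W: "cyl_wiener M \<beta>" and h: "0 < h" "h \<le> \<Delta>"
    and x: "x\<^sub>1 \<in> span (e ` {..<n})" "x\<^sub>2 \<in> span (e ` {..<n})"
    and scheme\<^sub>1: "\<forall>t\<ge>0. AE \<omega> in M.
        y\<^sub>1 t \<omega> = EI_rhs e lam n \<Delta> b (\<lambda>y. blinfun_apply (\<sigma> y)) \<beta> x\<^sub>1 y\<^sub>1 t \<omega>"
    and scheme\<^sub>2: "\<forall>t\<ge>0. AE \<omega> in M.
        y\<^sub>2 t \<omega> = EI_rhs e lam n \<Delta> b (\<lambda>y. blinfun_apply (\<sigma> y)) \<beta> x\<^sub>2 y\<^sub>2 t \<omega>"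
    and contr: "\<And>i. i < n \<Longrightarrow> (exp (- lam i * h))\<^sup>2 \<le> E"
    and hs: "\<And>u v. hs_sq e (blinfun_apply (\<sigma> u - \<sigma> v)) < \<infinity>"
    and diss: "\<And>u v. (norm (u - v + h *\<^sub>R (b u - b v)))\<^sup>2 + h * enn2real (hs_sq e (blinfun_apply (\<sigma> u - \<sigma> v)))
       \<le> K * (norm (u - v))\<^sup>2"
    and E: "0 \<le> E"
  shows "(\<integral>\<^sup>+\<omega>. ennreal ((norm (y\<^sub>1 (real j * \<Delta> + h) \<omega> - y\<^sub>2 (real j * \<Delta> + h) \<omega>))\<^sup>2) \<partial>M)
     \<le> ennreal (E * K) * (\<integral>\<^sup>+\<omega>. ennreal ((norm (y\<^sub>1 (real j * \<Delta>) \<omega> - y\<^sub>2 (real j * \<Delta>) \<omega>))\<^sup>2) \<partial>M)"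
proof -
  interpret prob_space M using W by (simp add: cyl_wiener_def)
  have \<Delta>: "0 < \<Delta>" using h by simp
  \<comment> \<open>The grid ends with a possibly shorter interval of length \<open>h\<close>; only
    its points up to index \<open>j + 1\<close> are used.\<close>
  define \<tau> where "\<tau> i = (if i \<le> j then real i * \<Delta> else real j * \<Delta> + h)" for i
  define V where "V ki \<omega> = \<beta> (fst ki) (\<tau> (Suc (snd ki))) \<omega> - \<beta> (fst ki) (\<tau> (snd ki)) \<omega>" for ki \<omega>
  define P where "P \<omega> = restrict (\<lambda>ki. V ki \<omega>) (UNIV \<times> {..<j})" for \<omega>
  define Q where "Q \<omega> = restrict (\<lambda>ki. V ki \<omega>) (UNIV \<times> {j})" for \<omega>
  define c where "c x = EI_chain \<Delta> (\<lambda>i. x \<bullet> e i) j" for x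
  define \<zeta> :: "(nat \<times> nat \<Rightarrow> real) \<Rightarrow> nat \<Rightarrow> real" where "\<zeta> q k = q (k, j)" for q k
  have indV: "indep_vars (\<lambda>_. borel) V (UNIV \<times> {..<Suc j})"
    unfolding V_def[abs_def]
    by (rule cyl_wiener_grid_indep[OF W]) (use \<Delta> h in \<open>auto simp: \<tau>_def less_Suc_eq algebra_simps\<close>)
  have ind: "indep_var (PiM (UNIV \<times> {..<j}) (\<lambda>_. borel)) P (PiM (UNIV \<times> {j}) (\<lambda>_. borel)) Q"
    unfolding P_def Q_def by (rule indep_var_restrict[OF indV]) auto
  have cm: "c x \<in> borel_measurable (PiM (UNIV \<times> {..<j}) (\<lambda>_. borel))" for x
    unfolding c_def by (intro EI_chain_measurable measurable_component_singleton) auto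
  have \<zeta>m: "\<zeta> \<in> borel_measurable (PiM (UNIV \<times> {j}) (\<lambda>_. borel))"
    unfolding \<zeta>_def[abs_def]
    by (intro measurable_coordinatewise_then_product measurable_component_singleton) auto
  have \<zeta>Q: "\<zeta> (Q \<omega>) k = \<beta> k (real j * \<Delta> + h) \<omega> - \<beta> k (real j * \<Delta>) \<omega>" for \<omega> k
    by (simp add: \<zeta>_def Q_def V_def \<tau>_def)
  have "indep_vars (\<lambda>_. borel) (\<lambda>k. V (k, j)) UNIV"
    by (rule indep_vars_reindex[OF indV]) (auto simp: inj_on_def)
  then have indZ: "indep_vars (\<lambda>_. borel) (\<lambda>k \<omega>. \<zeta> (Q \<omega>) k) UNIV"
    by (simp add: \<zeta>_def Q_def)
  have cP: "c x (P \<omega>) = EI_chain \<Delta> (\<lambda>i. x \<bullet> e i) j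
      (\<lambda>(k, i). \<beta> k (real (Suc i) * \<Delta>) \<omega> - \<beta> k (real i * \<Delta>) \<omega>)" for x \<omega>
    unfolding c_def by (rule EI_chain_cong) (simp add: P_def V_def \<tau>_def)
  have grid: "AE \<omega> in M. y (real j * \<Delta>) \<omega> = emb n (c x (P \<omega>))"
    and interm: "AE \<omega> in M. y (real j * \<Delta> + h) \<omega> = emb n (EI_step h (c x (P \<omega>)) (\<zeta> (Q \<omega>)))"
    if x: "x \<in> span (e ` {..<n})" and scheme: "\<forall>t\<ge>0. AE \<omega> in M.
        y t \<omega> = EI_rhs e lam n \<Delta> b (\<lambda>y. blinfun_apply (\<sigma> y)) \<beta> x y t \<omega>" for x y
  proof -
    show *: "AE \<omega> in M. y (real j * \<Delta>) \<omega> = emb n (c x (P \<omega>))"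
      unfolding cP by (rule scheme_eq_EI_chain[OF x \<Delta> scheme])
    have "\<zeta> (Q \<omega>) = (\<lambda>k. \<beta> k (real j * \<Delta> + h) \<omega> - \<beta> k (real j * \<Delta>) \<omega>)" for \<omega>
      by (simp add: fun_eq_iff \<zeta>Q)
    then show "AE \<omega> in M. y (real j * \<Delta> + h) \<omega> = emb n (EI_step h (c x (P \<omega>)) (\<zeta> (Q \<omega>)))"
      using scheme_eq_EI_step[OF x h scheme *] by simp
  qed
  have "(\<integral>\<^sup>+\<omega>. ennreal ((norm (y\<^sub>1 (real j * \<Delta> + h) \<omega> - y\<^sub>2 (real j * \<Delta> + h) \<omega>))\<^sup>2) \<partial>M)
      = (\<integral>\<^sup>+\<omega>. ennreal ((norm (emb n (EI_step h (c x\<^sub>1 (P \<omega>)) (\<zeta> (Q \<omega>)))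
          - emb n (EI_step h (c x\<^sub>2 (P \<omega>)) (\<zeta> (Q \<omega>)))))\<^sup>2) \<partial>M)"
    by (rule nn_integral_cong_AE, use interm[OF x(1) scheme\<^sub>1] interm[OF x(2) scheme\<^sub>2] in eventually_elim, simp)
  also have "\<dots> \<le> ennreal (E * K) *
      (\<integral>\<^sup>+\<omega>. ennreal ((norm (emb n (c x\<^sub>1 (P \<omega>)) - emb n (c x\<^sub>2 (P \<omega>))))\<^sup>2) \<partial>M)"
  proof (rule EI_step_mean_square[where P=P and Q=Q and \<zeta>=\<zeta>, OF prob_space_axioms ind cm cm \<zeta>m indZ])
    have j0: "0 \<le> real j * \<Delta>" "real j * \<Delta> < real j * \<Delta> + h" using \<Delta> h by auto
    note moments = cyl_wiener_increment_moments[OF W j0]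
    show "integrable M (\<lambda>\<omega>. (\<zeta> (Q \<omega>) k)\<^sup>2)" for k unfolding \<zeta>Q by (rule moments)
    show "expectation (\<lambda>\<omega>. \<zeta> (Q \<omega>) k) = 0" for k unfolding \<zeta>Q by (rule moments)
    show "expectation (\<lambda>\<omega>. (\<zeta> (Q \<omega>) k)\<^sup>2) = h" for k unfolding \<zeta>Q using moments(3) by simp
  qed (use h contr hs diss E in \<open>simp_all only: less_imp_le\<close>)
  also have "(\<integral>\<^sup>+\<omega>. ennreal ((norm (emb n (c x\<^sub>1 (P \<omega>)) - emb n (c x\<^sub>2 (P \<omega>))))\<^sup>2) \<partial>M)
      = (\<integral>\<^sup>+\<omega>. ennreal ((norm (y\<^sub>1 (real j * \<Delta>) \<omega> - y\<^sub>2 (real j * \<Delta>) \<omega>))\<^sup>2) \<partial>M)"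
    by (rule nn_integral_cong_AE, use grid[OF x(1) scheme\<^sub>1] grid[OF x(2) scheme\<^sub>2] in eventually_elim, simp)
  finally show ?thesis .
qed

end

text \<open>The contraction bound is tested on the eigenvector \<open>e i\<close>, where the
  semigroup acts as a scalar.\<close>

lemma (in orthonormal_sequence) eigenvalue_bound:
  assumes "norm (semigrp e lam t (e i)) \<le> exp (- \<alpha> * t) * norm (e i)"
  shows "(exp (- lam i * t))\<^sup>2 \<le> exp (- 2 * \<alpha> * t)"
proof -
  have ei: "e i = emb (Suc i) (\<lambda>j. e i \<bullet> e j)"
    by (rule emb_coords[symmetric]) (auto intro: span_base)
  have "(norm (semigrp e lam t (e i)))\<^sup>2 = (exp (- lam i * t))\<^sup>2"
    by (subst ei, subst semigrp_emb, subst norm_emb) (simp add: orthonormal)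
  moreover have "(norm (semigrp e lam t (e i)))\<^sup>2 \<le> (exp (- \<alpha> * t) * norm (e i))\<^sup>2"
    by (intro power_mono assms) auto
  moreover have "norm (e i) = 1" by (simp add: norm_eq_sqrt_inner orthonormal)
  ultimately show ?thesis by (simp add: exp_double[symmetric] mult.assoc)
qed

text \<open>For \<open>\<Delta> < 1\<close> the square of \<open>\<Delta>\<close> is at most
  \<open>\<Delta>\<close>, so taking roots gives
  \<open>\<Delta> < \<kappa> / (2 * \<rho>)\<close>.\<close>

lemma step_size_bound:
  fixes \<kappa> \<rho> \<Delta> l :: real
  assumes "0 < \<kappa>" "0 < \<rho>" "0 < \<Delta>" "\<Delta> < 1" "\<Delta> < \<kappa>\<^sup>2 / (4 * \<rho>\<^sup>2)" "l \<le> \<rho>"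
  shows "l * \<Delta> < \<kappa>"
proof -
  have "\<Delta>\<^sup>2 \<le> \<Delta>" using assms by (simp add: power2_eq_square mult_left_le)
  also have "\<dots> < (\<kappa> / (2 * \<rho>))\<^sup>2" using assms by (simp add: power_divide power_mult_distrib)
  finally have "\<Delta> < \<kappa> / (2 * \<rho>)" by (rule power_less_imp_less_base) (use assms in simp)
  then have "2 * (\<rho> * \<Delta>) < \<kappa>" using assms by (simp add: field_simps)
  moreover have "l * \<Delta> \<le> \<rho> * \<Delta>" "0 < \<rho> * \<Delta>" using assms by (auto intro: mult_right_mono)
  ultimately show ?thesis by linarith
qed

text \<open>Eigenvalues are indexed from 0, so \<open>lam (n - 1)\<close> is the n-th one. Property
  (P2) is this limit read along the grid times.\<close>

theorem theorem3p3:
  fixes e :: "nat \<Rightarrow> 'h::{real_inner,complete_space}"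
    and lam :: "nat \<Rightarrow> real"
    and \<alpha> \<gamma> \<theta>1 \<delta>1 L1 L2 \<Delta> :: real
    and b :: "'h \<Rightarrow> 'h"
    and \<sigma>0 :: "'h \<Rightarrow>\<^sub>L 'h"
    and \<sigma>1 :: "'h \<Rightarrow> ('h \<Rightarrow>\<^sub>L 'h)"
    and M :: "'w measure"
    and \<beta> :: "nat \<Rightarrow> real \<Rightarrow> 'w \<Rightarrow> real"
    and Y :: "'h \<Rightarrow> real \<Rightarrow> 'w \<Rightarrow> 'h"
    and n :: nat
    and U :: "'h set"
  assumes H1_basis: "orthonormal_basis e"
    and H1_eig_pos: "0 < lam 0"
    and H1_eig_mono: "mono lam"
    and H1_eig_infty: "filterlim lam at_top sequentially"
    and H1_alpha: "0 < \<alpha>"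
    and H1_contr: "\<forall>t\<ge>0. \<forall>x. norm (semigrp e lam t x) \<le> exp (- \<alpha> * t) * norm x"
    and H2: "0 < \<theta>1" "\<theta>1 < 1" "0 < \<delta>1"
      "\<forall>t>0. (\<integral>\<^sup>+ s\<in>{0..t}. hs_sq e (\<lambda>x. frac_semigrp e lam \<theta>1 s (\<sigma>0 x)) \<partial>lborel) \<le> ennreal \<delta>1"
    and H3_b: "0 \<le> L1" "\<forall>x y. norm (b x - b y) \<le> L1 * norm (x - y)"
    and H3_\<sigma>: "0 \<le> L2" "\<forall>x. hs_sq e (blinfun_apply (\<sigma>1 x)) < \<infinity>"
      "\<forall>x y. hs_sq e (blinfun_apply (\<sigma>1 x - \<sigma>1 y)) \<le> ennreal ((L2 * norm (x - y))\<^sup>2)"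
    and H4: "\<forall>x y. 2 * ((x - y) \<bullet> (b x - b y)) + enn2real (hs_sq e (blinfun_apply (\<sigma>1 x - \<sigma>1 y)))
                 \<le> - \<gamma> * (norm (x - y))\<^sup>2"
    and pos: "2 * \<alpha> + \<gamma> > 0"
    and W: "cyl_wiener M \<beta>"
    and n_pos: "1 \<le> n"
    and step_pos: "0 < \<Delta>"
    and step_small:
      "\<Delta> < min 1 ((2 * \<alpha> + \<gamma>)\<^sup>2 / (4 * (
          let \<mu> = (norm (b 0))\<^sup>2 + enn2real (hs_sq e (blinfun_apply (\<sigma>1 0)));
              Lbar = 2 * max (L1\<^sup>2 + L2\<^sup>2) \<mu>;
              ln = lam (n - 1)
          in 6 * (ln\<^sup>2 + Lbar) * (\<bar>2 * \<alpha> - \<gamma>\<bar> + 1) + 3 + 7 * Lbar + ln\<^sup>2 * Lbar + 6 * ln\<^sup>2)\<^sup>2))"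
    and scheme: "\<forall>x\<in>span (e ` {..<n}). \<forall>t\<ge>0. AE \<omega> in M.
        Y x t \<omega> = EI_rhs e lam n \<Delta> b (\<lambda>y. blinfun_apply (\<sigma>0 + \<sigma>1 y)) \<beta> x (Y x) t \<omega>"
    and U_bdd: "bounded U" and U_sub: "U \<subseteq> span (e ` {..<n})"
  shows "((\<lambda>t. SUP x\<in>U. SUP y\<in>U. \<integral>\<^sup>+ \<omega>. ennreal ((norm (Y x t \<omega> - Y y t \<omega>))\<^sup>2) \<partial>M)
           \<longlongrightarrow> 0) at_top"
proof -
  interpret orthonormal_sequence e
    using H1_basis by unfold_locales (simp add: orthonormal_basis_def)

  \<comment> \<open>Regularity of the coefficients and the one-step estimate\<close>
  have hs_fin: "hs_sq e (blinfun_apply (\<sigma>1 u - \<sigma>1 v)) < \<infinity>" for u v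
    by (rule le_less_trans[OF H3_\<sigma>(3)[rule_format]]) simp
  \<comment> \<open>A single column is dominated by the Hilbert-Schmidt norm, and
    \<open>\<sigma>0\<close> cancels in the difference.\<close>
  have \<sigma>_lip: "norm (blinfun_apply (\<sigma>0 + \<sigma>1 u) (e k) - blinfun_apply (\<sigma>0 + \<sigma>1 v) (e k)) \<le> L2 * norm (u - v)"
    for u v k
  proof -
    have "(norm (blinfun_apply (\<sigma>1 u - \<sigma>1 v) (e k)))\<^sup>2 \<le> enn2real (hs_sq e (blinfun_apply (\<sigma>1 u - \<sigma>1 v)))"
      by (rule norm_apply_le_hs[OF hs_fin])
    also have "\<dots> \<le> (L2 * norm (u - v))\<^sup>2"
      using H3_\<sigma>(3) by (intro enn2real_leI) auto
    finally have "norm (blinfun_apply (\<sigma>1 u - \<sigma>1 v) (e k)) \<le> L2 * norm (u - v)"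
      by (rule power2_le_imp_le) (use H3_\<sigma>(1) in simp)
    then show ?thesis by (simp add: blinfun.add_left blinfun.diff_left)
  qed
  interpret EI_scheme e lam n b "\<lambda>y. \<sigma>0 + \<sigma>1 y"
  proof
    have "L1-lipschitz_on UNIV b"
      using H3_b by (auto simp: lipschitz_on_def dist_norm)
    then show "continuous_on UNIV b" by (rule lipschitz_on_continuous_on)
    have "L2-lipschitz_on UNIV (\<lambda>y. blinfun_apply (\<sigma>0 + \<sigma>1 y) (e k))" for k
      using \<sigma>_lip H3_\<sigma>(1) by (auto simp: lipschitz_on_def dist_norm)
    then show "continuous_on UNIV (\<lambda>y. blinfun_apply (\<sigma>0 + \<sigma>1 y) (e k))" for k
      by (rule lipschitz_on_continuous_on)
  qed
  \<comment> \<open>The linear term of \<open>K\<close> comes from (H4), the quadratic one from the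
    squared drift increment; \<open>E\<close> is the squared decay of the semigroup.\<close>
  define K where "K h = 1 - \<gamma> * h + L1\<^sup>2 * h\<^sup>2" for h
  define E where "E h = exp (- 2 * \<alpha> * h)" for h
  have diss: "(norm (u - v + h *\<^sub>R (b u - b v)))\<^sup>2
      + h * enn2real (hs_sq e (blinfun_apply ((\<sigma>0 + \<sigma>1 u) - (\<sigma>0 + \<sigma>1 v)))) \<le> K h * (norm (u - v))\<^sup>2"
    if "0 \<le> h" for u v h
  proof -
    let ?N = "enn2real (hs_sq e (blinfun_apply (\<sigma>1 u - \<sigma>1 v)))"
    have "(norm (u - v + h *\<^sub>R (b u - b v)))\<^sup>2 + h * ?N
        = (norm (u - v))\<^sup>2 + h * (2 * ((u - v) \<bullet> (b u - b v)) + ?N) + h\<^sup>2 * (norm (b u - b v))\<^sup>2"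
      by (simp only: power2_norm_eq_inner inner_add inner_scaleR_left inner_scaleR_right
          inner_commute[of "b u - b v" "u - v"]) algebra
    also have "\<dots> \<le> (norm (u - v))\<^sup>2 + h * (- \<gamma> * (norm (u - v))\<^sup>2) + h\<^sup>2 * (L1 * norm (u - v))\<^sup>2"
      using H4 H3_b(2) that by (intro add_mono mult_left_mono power_mono order_refl) auto
    also have "\<dots> = K h * (norm (u - v))\<^sup>2"
      by (simp add: K_def power_mult_distrib algebra_simps)
    finally show ?thesis by simp
  qed
  define D where "D x y t = (\<integral>\<^sup>+ \<omega>. ennreal ((norm (Y x t \<omega> - Y y t \<omega>))\<^sup>2) \<partial>M)" for x y t
  have D_step: "D x y (real j * \<Delta> + h) \<le> ennreal (E h * K h) * D x y (real j * \<Delta>)"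
    if "x \<in> U" "y \<in> U" "0 < h" "h \<le> \<Delta>" for x y j h
    unfolding D_def
  proof (rule scheme_mean_square_step[OF W that(3,4)])
    show "x \<in> span (e ` {..<n})" "y \<in> span (e ` {..<n})" using that U_sub by auto
    then show "\<forall>t\<ge>0. AE \<omega> in M. Y x t \<omega> = EI_rhs e lam n \<Delta> b (\<lambda>y. blinfun_apply (\<sigma>0 + \<sigma>1 y)) \<beta> x (Y x) t \<omega>"
      "\<forall>t\<ge>0. AE \<omega> in M. Y y t \<omega> = EI_rhs e lam n \<Delta> b (\<lambda>y. blinfun_apply (\<sigma>0 + \<sigma>1 y)) \<beta> y (Y y) t \<omega>"
      using scheme by auto
    show "(exp (- lam i * h))\<^sup>2 \<le> E h" for i
      unfolding E_def using H1_contr that(3) by (intro eigenvalue_bound) auto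
    show "hs_sq e (blinfun_apply (\<sigma>0 + \<sigma>1 u - (\<sigma>0 + \<sigma>1 v))) < \<infinity>" for u v
      using hs_fin by simp
    show "0 \<le> E h" by (simp add: E_def)
  qed (use diss that in auto)
  \<comment> \<open>The cut at 0 gives a nonnegative ratio without discussing the sign of
    \<open>K \<Delta>\<close>.\<close>
  define q where "q = max 0 (E \<Delta> * K \<Delta>)"
  have q0: "0 \<le> q" by (simp add: q_def)
  have q1: "q < 1"
  proof -
    define Lbar where "Lbar = 2 * max (L1\<^sup>2 + L2\<^sup>2) ((norm (b 0))\<^sup>2 + enn2real (hs_sq e (blinfun_apply (\<sigma>1 0))))"
    define \<rho> where "\<rho> = 6 * ((lam (n - 1))\<^sup>2 + Lbar) * (\<bar>2 * \<alpha> - \<gamma>\<bar> + 1) + 3 + 7 * Lbar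
        + (lam (n - 1))\<^sup>2 * Lbar + 6 * (lam (n - 1))\<^sup>2"
    have small: "\<Delta> < 1" "\<Delta> < (2 * \<alpha> + \<gamma>)\<^sup>2 / (4 * \<rho>\<^sup>2)"
      using step_small unfolding Let_def Lbar_def[symmetric] \<rho>_def[symmetric] by auto
    have Lbar: "L1\<^sup>2 \<le> Lbar" unfolding Lbar_def
      using zero_le_power2[of L1] zero_le_power2[of L2] max.cobounded1[of "L1\<^sup>2 + L2\<^sup>2"] by (smt (verit))
    then have Lbar0: "0 \<le> Lbar" using zero_le_power2[of L1] by linarith
    have "0 \<le> 6 * ((lam (n - 1))\<^sup>2 + Lbar) * (\<bar>2 * \<alpha> - \<gamma>\<bar> + 1)" "0 \<le> (lam (n - 1))\<^sup>2 * Lbar"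
      "0 \<le> (lam (n - 1))\<^sup>2" using Lbar0 by auto
    \<comment> \<open>All other summands of \<open>\<rho>\<close> are nonnegative, so
      \<open>\<rho>\<close> dominates the squared Lipschitz constant of \<open>b\<close> and is
      positive.\<close>
    then have "3 + Lbar \<le> \<rho>" unfolding \<rho>_def using Lbar0 by linarith
    then have "L1\<^sup>2 * \<Delta> < 2 * \<alpha> + \<gamma>"
      using Lbar Lbar0 pos step_pos small by (intro step_size_bound[of _ \<rho>]) auto
    \<comment> \<open>One more factor \<open>\<Delta>\<close> matches the quadratic term of
      \<open>K \<Delta>\<close>, leaving \<open>1 + 2 * \<alpha> * \<Delta>\<close>, which the
      exponential decay outweighs.\<close>
    then have "L1\<^sup>2 * \<Delta> * \<Delta> < (2 * \<alpha> + \<gamma>) * \<Delta>"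
      using step_pos by (rule mult_strict_right_mono)
    then have "K \<Delta> < 1 + 2 * \<alpha> * \<Delta>"
      by (simp add: K_def power2_eq_square algebra_simps)
    also have "\<dots> \<le> exp (2 * \<alpha> * \<Delta>)" by (rule exp_ge_add_one_self)
    finally have "E \<Delta> * K \<Delta> < E \<Delta> * exp (2 * \<alpha> * \<Delta>)"
      by (intro mult_strict_left_mono) (auto simp: E_def)
    then show ?thesis by (simp add: q_def E_def exp_minus)
  qed

  \<comment> \<open>Geometric decay, uniformly over the initial values\<close>
  obtain R where R: "\<And>x. x \<in> U \<Longrightarrow> norm x \<le> R"
    using U_bdd unfolding bounded_iff by auto
  \<comment> \<open>\<open>2 * R\<close> bounds the distance of any two initial points, so the
    estimate depends on \<open>x\<close> and \<open>y\<close> only through \<open>R\<close>.\<close>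
  have D_grid: "D x y (real j * \<Delta>) \<le> ennreal (q ^ j * (2 * R)\<^sup>2)" if xy: "x \<in> U" "y \<in> U" for x y j
  proof (induction j)
    case 0
    have init: "AE \<omega> in M. Y x 0 \<omega> = x" if "x \<in> U" for x
    proof -
      have x: "x \<in> span (e ` {..<n})" using that U_sub by auto
      show ?thesis
        using scheme_eq_EI_chain[OF x step_pos scheme[THEN bspec, OF x], of 0] by (simp add: emb_coords[OF x])
    qed
    interpret prob_space M using W by (simp add: cyl_wiener_def)
    have "D x y 0 = (\<integral>\<^sup>+ \<omega>. ennreal ((norm (x - y))\<^sup>2) \<partial>M)"
      unfolding D_def by (rule nn_integral_cong_AE, use init[OF xy(1)] init[OF xy(2)] in eventually_elim, simp)
    also have "\<dots> = ennreal ((norm (x - y))\<^sup>2)" by (simp add: emeasure_space_1)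
    also have "\<dots> \<le> ennreal ((2 * R)\<^sup>2)"
      using norm_triangle_ineq4[of x y] R[OF xy(1)] R[OF xy(2)]
      by (intro ennreal_leI power_mono) auto
    finally show ?case by simp
  next
    case (Suc j)
    have "D x y (real (Suc j) * \<Delta>) = D x y (real j * \<Delta> + \<Delta>)" by (simp add: algebra_simps)
    also have "\<dots> \<le> ennreal (E \<Delta> * K \<Delta>) * D x y (real j * \<Delta>)"
      by (rule D_step[OF xy step_pos order_refl])
    also have "\<dots> \<le> ennreal q * ennreal (q ^ j * (2 * R)\<^sup>2)"
      by (intro mult_mono ennreal_leI Suc) (auto simp: q_def)
    also have "\<dots> = ennreal (q ^ Suc j * (2 * R)\<^sup>2)"
      using q0 by (simp add: ennreal_mult'[symmetric] mult.assoc)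
    finally show ?case .
  qed
  \<comment> \<open>Bounds \<open>E h * K h\<close> for every partial step; it may exceed 1 but is
    paid only once.\<close>
  define C where "C = 1 + \<bar>\<gamma>\<bar> * \<Delta> + L1\<^sup>2 * \<Delta>\<^sup>2"
  have C0: "0 \<le> C" using step_pos by (simp add: C_def)
  \<comment> \<open>The last grid index strictly before \<open>t\<close>: ceiling minus one, instead
    of the floor, leaves a remainder in the half-open range from 0 (excluded) to
    \<open>\<Delta>\<close>, as the one-step estimate requires.\<close>
  define J where "J t = nat \<lceil>t / \<Delta>\<rceil> - 1" for t
  have D_bound: "D x y t \<le> ennreal (C * (q ^ J t * (2 * R)\<^sup>2))" if xy: "x \<in> U" "y \<in> U" and t: "0 < t" for x y t
  proof -
    define h where "h = t - real (J t) * \<Delta>"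
    have "1 \<le> \<lceil>t / \<Delta>\<rceil>" using t step_pos by simp
    then have "real (J t) = of_int \<lceil>t / \<Delta>\<rceil> - 1" by (simp add: J_def of_nat_diff nat_le_iff le_nat_iff)
    then have "real (J t) < t / \<Delta>" "t / \<Delta> \<le> real (J t) + 1" by linarith+
    then have h: "0 < h" "h \<le> \<Delta>" using step_pos by (auto simp: h_def field_simps)
    have "E h * K h \<le> C"
    proof -
      have "- \<gamma> * h \<le> \<bar>\<gamma>\<bar> * \<Delta>" using h by (intro mult_mono) auto
      moreover have "L1\<^sup>2 * h\<^sup>2 \<le> L1\<^sup>2 * \<Delta>\<^sup>2" using h by (intro mult_left_mono power_mono) auto
      ultimately have "K h \<le> C" by (simp add: K_def C_def)
      then have "E h * K h \<le> E h * C" by (intro mult_left_mono) (simp_all add: E_def)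
      also have "\<dots> \<le> 1 * C" using C0 H1_alpha h by (intro mult_right_mono) (auto simp: E_def)
      finally show ?thesis by simp
    qed
    then have "ennreal (E h * K h) * D x y (real (J t) * \<Delta>) \<le> ennreal C * ennreal (q ^ J t * (2 * R)\<^sup>2)"
      by (intro mult_mono ennreal_leI D_grid xy) auto
    then show ?thesis
      using D_step[OF xy h, of "J t"] C0 by (simp add: h_def ennreal_mult'[symmetric])
  qed

  \<comment> \<open>Passage to the limit\<close>
  have J_lim: "filterlim J at_top at_top"
    unfolding filterlim_at_top
  proof
    fix Z
    show "\<forall>\<^sub>F t in at_top. Z \<le> J t"
      using eventually_ge_at_top[of "real (Suc Z) * \<Delta>"]
    proof eventually_elim
      case (elim t)
      then have "real (Suc Z) \<le> t / \<Delta>" using step_pos by (simp add: field_simps)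
      then have "int (Suc Z) \<le> \<lceil>t / \<Delta>\<rceil>" by linarith
      then show ?case by (simp add: J_def)
    qed
  qed
  have "(\<lambda>j. C * (q ^ j * (2 * R)\<^sup>2)) \<longlonglongrightarrow> C * (0 * (2 * R)\<^sup>2)"
    by (intro tendsto_intros LIMSEQ_realpow_zero) (use q1 in \<open>auto simp: q_def\<close>)
  then have "(\<lambda>j. ennreal (C * (q ^ j * (2 * R)\<^sup>2))) \<longlonglongrightarrow> 0"
    using tendsto_ennrealI by fastforce
  then have lim: "((\<lambda>t. ennreal (C * (q ^ J t * (2 * R)\<^sup>2))) \<longlongrightarrow> 0) at_top"
    by (rule filterlim_compose[OF _ J_lim])
  \<comment> \<open>The bound is free of \<open>x\<close> and \<open>y\<close> and therefore passes
    through both suprema.\<close>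
  have "((\<lambda>t. SUP x\<in>U. SUP y\<in>U. D x y t) \<longlongrightarrow> 0) at_top"
  proof (rule tendsto_sandwich[OF _ _ tendsto_const lim])
    show "\<forall>\<^sub>F t in at_top. (SUP x\<in>U. SUP y\<in>U. D x y t) \<le> ennreal (C * (q ^ J t * (2 * R)\<^sup>2))"
      using eventually_gt_at_top[of 0] by eventually_elim (intro SUP_least D_bound)
  qed simp
  then show ?thesis by (simp add: D_def)
qed

end
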